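(* Let $q\in L^1(0,\infty)$ be real-valued and let $H^N$ be the self-adjoint operator in $L^2(0,\infty)$ given by $H^N\varphi=-\varphi''+(x+q(x))\varphi$ on the domain of $\varphi\in L^2(0,\infty)$ with $\varphi,\varphi'$ locally absolutely continuous on $[0,\infty)$, $-\varphi''+(x+q)\varphi\in L^2(0,\infty)$, and $\varphi'(0)=0$. Let $\lambda_1^N<\lambda_2^N<\cdots$ be its (simple) eigenvalues, and define the norming constants $\nu_k^N$ by \[ \frac{1}{\nu_k^N}=\frac{\|\varphi_k\|_{L^2(0,\infty)}^2}{\big(\varphi_k(0)\big)^2}, \] where $\varphi_k$ is any nonzero eigenfunction of $H^N$ for $\lambda_k^N$. Then \[ \frac{1}{\nu_k^N}=\left(\tfrac32\pi\big(k-\tfrac34\big)\right)^{2/3}\big(1+o(1)\big),\qquad k\to\infty. \]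
   Context: The quotient defining $\nu_k^N$ does not depend on the choice of the (one-dimensional) eigenfunction $\varphi_k$. *)

theory Defs
  imports "HOL-Analysis.Analysis" "HOL-Library.Landau_Symbols"
begin

text \<open>Locally absolute continuity on [0,\<infinity>) is expressed literally via the
Lebesgue fundamental theorem: f x = f 0 + integral of an L^1_loc function g over [0,x].\<close>

definition loc_AC_deriv :: "(real \<Rightarrow> real) \<Rightarrow> (real \<Rightarrow> real) \<Rightarrow> bool" where
  "loc_AC_deriv f g \<longleftrightarrow>
     (\<forall>x\<ge>0. g absolutely_integrable_on {0..x} \<and> f x = f 0 + integral {0..x} g)"

definition is_eigenfunction_N ::
  "(real \<Rightarrow> real) \<Rightarrow> real \<Rightarrow> (real \<Rightarrow> real) \<Rightarrow> bool" where
  "is_eigenfunction_N q lam phi \<longleftrightarrow>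
     (\<exists>phi1 phi2.
        loc_AC_deriv phi phi1 \<and> loc_AC_deriv phi1 phi2 \<and>
        (\<lambda>x. (phi x)\<^sup>2) integrable_on {0..} \<and>
        (\<lambda>x. (- phi2 x + (x + q x) * phi x)\<^sup>2) integrable_on {0..} \<and>
        phi1 0 = 0 \<and>
        (AE x in lebesgue. 0 \<le> x \<longrightarrow> - phi2 x + (x + q x) * phi x = lam * phi x)) \<and>
     (\<exists>x\<ge>0. phi x \<noteq> 0)"

definition eigenvalues_N :: "(real \<Rightarrow> real) \<Rightarrow> real set" where
  "eigenvalues_N q = {lam. \<exists>phi. is_eigenfunction_N q lam phi}"

definition eigenvalue_N :: "(real \<Rightarrow> real) \<Rightarrow> nat \<Rightarrow> real" where
  "eigenvalue_N q k =
     (THE lam. lam \<in> eigenvalues_N q \<and> card {m \<in> eigenvalues_N q. m < lam} = k - 1)"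

definition inv_norming_const_N :: "(real \<Rightarrow> real) \<Rightarrow> nat \<Rightarrow> real" where
  "inv_norming_const_N q k =
     (let phi = (SOME phi. is_eigenfunction_N q (eigenvalue_N q k) phi)
      in integral {0..} (\<lambda>x. (phi x)\<^sup>2) / (phi 0)\<^sup>2)"

end

theory Submission
  imports Defs
begin

text \<open>
  With \<open>Q(x) = \<integral>\<^sub>0\<^sup>x q\<close> and the quasi-derivative \<open>v = u' - Q u\<close>, the eigenvalue equation becomes the
  system \<open>u' = Q u + v\<close>, \<open>v' = (x - lam - Q\<^sup>2) u - Q v\<close> with continuous coefficients.

  Eigenvalues. The Pruefer angle \<open>theta\<close> of \<open>(u, v)\<close>, started at \<open>\<pi>/2\<close>, increases with \<open>lam\<close>. Beyond the
  turning point \<open>(u v)' \<ge> u\<^sup>2 + v\<^sup>2\<close>, so that \<open>u\<close> is square integrable iff \<open>u v\<close> stays negative, i.e. iff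
  \<open>theta\<close> stays in an interval \<open>((m + 1/2) \<pi>, (m + 1) \<pi>)\<close>; a connectedness argument in \<open>lam\<close> gives exactly
  one such \<open>lam = mu m\<close> for every \<open>m\<close>. Rescaling the angle by \<open>\<surd>(lam - x)\<close> shows that it equals
  \<open>2/3 lam\<^bsup>3/2\<^esup> + O(lam)\<close> at the turning point, whence the asymptotics of \<open>mu m\<close>.

  Norming constants. The energy \<open>E = u'\<^sup>2 + (lam - x) u\<^sup>2\<close> satisfies \<open>E' = - u\<^sup>2 + 2 q u u'\<close>, \<open>E(0) = lam\<close>
  and \<open>E(\<infinity>) = 0\<close>, so that \<open>\<integral> u\<^sup>2 = lam + 2 \<integral> q u u'\<close>. The last integral is \<open>o(lam)\<close>:
  \<open>u u' = O(lam\<^bsup>1/2\<^esup>)\<close> on \<open>[0, lam/2]\<close>, while \<open>u u' = O(lam)\<close> everywhere and the tail of \<open>q\<close> is small.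
\<close>

subsection \<open>Differential inequalities and a scalar initial value problem\<close>

text \<open>The obstacle is that \<open>q\<close> is merely integrable: it has no pointwise bound,
  and \<open>u''\<close> exists only almost everywhere. In the pair \<open>(u, v)\<close> it enters
  through the bounded continuous function \<open>Q\<close> alone, so solutions can be compared by
  classical derivatives. Absolute continuity remains at the interface with eigenfunctions and in the
  energy, whose derivative contains \<open>q\<close>.

  The solution is built from its angle. The angle equation is scalar and, at each fixed
  \<open>x\<close>, bounded and Lipschitz, so a single contraction solves it on the whole half-line;
  the amplitude follows by a quadrature.

  No approximate solution is needed near the turning point: a window of fixed width around it costs
  a bounded rotation and a bounded growth factor. Limits at infinity are also avoided: a nonnegative
  function with bounded integrals is small at arbitrarily distant points, which suffices to
  contradict a growing Wronskian or to end the integration of the energy.\<close>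

lemma mvt_within:
  fixes f f' :: "real \<Rightarrow> real"
  assumes "a \<le> b" and sub: "{a..b} \<subseteq> S"
    and der: "\<And>x. x \<in> {a..b} \<Longrightarrow> (f has_real_derivative f' x) (at x within S)"
  shows "\<exists>x\<in>{a..b}. f b - f a = f' x * (b - a)"
proof (rule mvt_very_simple[OF \<open>a \<le> b\<close>])
  fix x assume "a \<le> x" "x \<le> b"
  then have "(f has_real_derivative f' x) (at x within {a..b})"
    using der[of x] sub by (auto intro: DERIV_subset)
  then show "(f has_derivative (*) (f' x)) (at x within {a..b})"
    by (simp add: has_field_derivative_def)
qed

lemma deriv_within_nonneg_mono:
  fixes f f' :: "real \<Rightarrow> real"
  assumes "a \<le> b" "{a..b} \<subseteq> S"
    and "\<And>x. x \<in> {a..b} \<Longrightarrow> (f has_real_derivative f' x) (at x within S)"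
    and nonneg: "\<And>x. x \<in> {a..b} \<Longrightarrow> 0 \<le> f' x"
  shows "f a \<le> f b"
  using mvt_within[OF assms(1-3)] nonneg \<open>a \<le> b\<close>
  by (metis diff_ge_0_iff_ge mult_nonneg_nonneg)

lemma deriv_within_pos_strict_mono:
  fixes f f' :: "real \<Rightarrow> real"
  assumes "a < b" "{a..b} \<subseteq> S"
    and "\<And>x. x \<in> {a..b} \<Longrightarrow> (f has_real_derivative f' x) (at x within S)"
    and pos: "\<And>x. x \<in> {a..b} \<Longrightarrow> 0 < f' x"
  shows "f a < f b"
  using mvt_within[OF less_imp_le[OF assms(1)] assms(2,3)] pos \<open>a < b\<close>
  by (metis diff_gt_0_iff_gt mult_pos_pos)

lemma deriv_within_diff_le:
  fixes f f' g g' :: "real \<Rightarrow> real"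
  assumes "a \<le> b" "{a..b} \<subseteq> S"
    and "\<And>x. x \<in> {a..b} \<Longrightarrow> (f has_real_derivative f' x) (at x within S)"
    and "\<And>x. x \<in> {a..b} \<Longrightarrow> (g has_real_derivative g' x) (at x within S)"
    and "\<And>x. x \<in> {a..b} \<Longrightarrow> f' x \<le> g' x"
  shows "f b - f a \<le> g b - g a"
  using deriv_within_nonneg_mono[of a b S "\<lambda>x. g x - f x" "\<lambda>x. g' x - f' x"] assms
  by (force intro!: derivative_intros)

lemma deriv_within_abs_diff_le:
  fixes f f' :: "real \<Rightarrow> real"
  assumes "a \<le> b" "{a..b} \<subseteq> S"
    and der: "\<And>x. x \<in> {a..b} \<Longrightarrow> (f has_real_derivative f' x) (at x within S)"
    and bd: "\<And>x. x \<in> {a..b} \<Longrightarrow> \<bar>f' x\<bar> \<le> B"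
  shows "\<bar>f b - f a\<bar> \<le> B * (b - a)"
proof -
  have lin: "((\<lambda>x. c * x) has_real_derivative c) (at x within S)" for c x
    by (auto intro!: derivative_eq_intros)
  have "f b - f a \<le> B * b - B * a"
    by (rule deriv_within_diff_le[OF assms(1,2) der lin]) (use bd in \<open>auto simp: abs_le_iff\<close>)
  moreover have "(-B) * b - (-B) * a \<le> f b - f a"
    by (rule deriv_within_diff_le[OF assms(1,2) lin der]) (use bd in \<open>force simp: abs_le_iff\<close>)+
  ultimately show ?thesis
    by (simp add: abs_le_iff algebra_simps)
qed

lemma gronwall_within:
  fixes F F' :: "real \<Rightarrow> real"
  assumes "a \<le> b" "{a..b} \<subseteq> S"
    and der: "\<And>x. x \<in> {a..b} \<Longrightarrow> (F has_real_derivative F' x) (at x within S)"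
    and le: "\<And>x. x \<in> {a..b} \<Longrightarrow> F' x \<le> L * F x"
  shows "F b \<le> F a * exp (L * (b - a))"
proof -
  have "- (F a * exp (- L * a)) \<le> - (F b * exp (- L * b))"
  proof (rule deriv_within_nonneg_mono[OF assms(1,2)])
    fix x assume x: "x \<in> {a..b}"
    show "((\<lambda>x. - (F x * exp (- L * x))) has_real_derivative (L * F x - F' x) * exp (- L * x))
        (at x within S)"
      by (auto intro!: derivative_eq_intros der[OF x] simp: algebra_simps)
    show "0 \<le> (L * F x - F' x) * exp (- L * x)"
      using le[OF x] by simp
  qed
  then have "F b * exp (- L * b) * exp (L * b) \<le> F a * exp (- L * a) * exp (L * b)"
    by (intro mult_right_mono) auto
  then show ?thesis
    by (simp add: exp_minus exp_diff field_simps)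
qed

text \<open>The squared negative part is differentiable even at \<open>0\<close>, so Gronwall
  applies to it; this is what makes one-sided comparison possible.\<close>

lemma has_real_derivative_min_0_power2:
  "((\<lambda>y::real. (min 0 y)\<^sup>2) has_real_derivative 2 * min 0 y) (at y)"
proof -
  consider "y < 0" | "y > 0" | "y = 0" by linarith
  then show ?thesis
  proof cases
    case 1
    have "((\<lambda>y::real. y\<^sup>2) has_real_derivative 2 * min 0 y) (at y)"
      using 1 by (auto intro!: derivative_eq_intros)
    then show ?thesis
      by (rule has_field_derivative_transform_within_open[of _ _ _ "{..<0}"]) (use 1 in auto)
  next
    case 2
    have "((\<lambda>y::real. 0) has_real_derivative 2 * min 0 y) (at y)"
      using 2 by (auto intro!: derivative_eq_intros)
    then show ?thesis
      by (rule has_field_derivative_transform_within_open[of _ _ _ "{0<..}"]) (use 2 in auto)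
  next
    case 3
    have "((\<lambda>h::real. (min 0 h)\<^sup>2 / h) \<longlongrightarrow> 0) (at 0)"
    proof (rule Lim_null_comparison)
      show "\<forall>\<^sub>F h in at 0. norm ((min 0 h)\<^sup>2 / h) \<le> \<bar>h::real\<bar>"
        by (auto simp: eventually_at min_def power2_eq_square intro!: exI[of _ 1])
      show "((\<lambda>h::real. \<bar>h\<bar>) \<longlongrightarrow> 0) (at 0)"
        by (auto intro!: tendsto_eq_intros)
    qed
    then show ?thesis
      using 3 by (simp add: DERIV_def)
  qed
qed

text \<open>Gronwall for the squared negative part of \<open>d\<close>: it starts at
  \<open>0\<close>, is stationary where \<open>d\<close> is nonnegative, and elsewhere grows at rate
  at most \<open>2 * L\<close>. With \<open>d\<close> the distance to a barrier, a Lipschitz bound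
  supplies the hypothesis.\<close>

lemma differential_inequality_nonneg:
  fixes d d' :: "real \<Rightarrow> real"
  assumes ab: "a \<le> b" "{a..b} \<subseteq> S"
    and der: "\<And>x. x \<in> {a..b} \<Longrightarrow> (d has_real_derivative d' x) (at x within S)"
    and ge: "\<And>x. x \<in> {a..b} \<Longrightarrow> - L * \<bar>d x\<bar> \<le> d' x"
    and "0 \<le> d a"
  shows "0 \<le> d b"
proof -
  have "(min 0 (d b))\<^sup>2 \<le> (min 0 (d a))\<^sup>2 * exp (2 * L * (b - a))"
  proof (rule gronwall_within[OF ab])
    fix x assume x: "x \<in> {a..b}"
    show "((\<lambda>x. (min 0 (d x))\<^sup>2) has_real_derivative 2 * min 0 (d x) * d' x) (at x within S)"
      using DERIV_chain2[OF has_real_derivative_min_0_power2 der[OF x]] by simp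
    have "d' x * min 0 (d x) \<le> (- L * \<bar>d x\<bar>) * min 0 (d x)"
      by (rule mult_right_mono_neg[OF ge[OF x]]) simp
    then show "2 * min 0 (d x) * d' x \<le> 2 * L * (min 0 (d x))\<^sup>2"
      by (auto simp: min_def power2_eq_square algebra_simps split: if_splits)
  qed
  with \<open>0 \<le> d a\<close> have "(min 0 (d b))\<^sup>2 \<le> 0" by simp
  then show ?thesis by (simp add: min_def split: if_splits)
qed

lemma deriv_within_imp_continuous_on:
  fixes f :: "real \<Rightarrow> real"
  assumes "\<And>x. x \<in> S \<Longrightarrow> (f has_real_derivative f' x) (at x within S)"
  shows "continuous_on S f"
  using assms DERIV_continuous continuous_on_eq_continuous_within by blast

lemma integral_has_real_derivative_atLeast:
  fixes g :: "real \<Rightarrow> real"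
  assumes "continuous_on {a..} g" "a \<le> t"
  shows "((\<lambda>x. integral {a..x} g) has_real_derivative g t) (at t within {a..})"
proof -
  have "((\<lambda>x. integral {a..x} g) has_real_derivative g t) (at t within {a..t+1})"
    by (rule integral_has_real_derivative) (use assms in \<open>auto intro: continuous_on_subset\<close>)
  moreover have "at t within {a..t+1} = at t within {a..}"
    by (rule at_within_nhd[of _ "{..<t+1}"]) auto
  ultimately show ?thesis by simp
qed

text \<open>Picard iteration in a weighted norm: the unknown is
  \<open>g = (y - y0) * exp (- M)\<close> with \<open>M' = 2 L\<close>. As the integral of
  \<open>L * exp M\<close> is \<open>(exp M - 1) / 2\<close>, the map on \<open>g\<close> contracts
  by \<open>1/2\<close> on the whole half-line, and no local solutions have to be glued. The bound
  on \<open>f\<close> keeps the image bounded.\<close>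

lemma scalar_ode_exists:
  fixes f :: "real \<Rightarrow> real \<Rightarrow> real" and L M :: "real \<Rightarrow> real"
  assumes cont: "continuous_on ({0..} \<times> UNIV) (\<lambda>(t, y). f t y)"
    and lip: "\<And>t y z. 0 \<le> t \<Longrightarrow> \<bar>f t y - f t z\<bar> \<le> L t * \<bar>y - z\<bar>"
    and bd: "\<And>t y. 0 \<le> t \<Longrightarrow> \<bar>f t y\<bar> \<le> L t"
    and M: "\<And>t. 0 \<le> t \<Longrightarrow> (M has_real_derivative 2 * L t) (at t within {0..})"
    and M0: "M 0 = 0" and L: "continuous_on {0..} L"
  obtains y where "y 0 = y0"
    "\<And>t. 0 \<le> t \<Longrightarrow> (y has_real_derivative f t (y t)) (at t within {0..})"
proof -
  define F where "F g t = f t (y0 + g t * exp (M t))" for g :: "real \<Rightarrow> real" and t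
  \<comment> \<open>The fixed point is sought among bounded continuous functions on the whole line;
    \<open>max 0 x\<close> extends constantly to the left of \<open>0\<close>.\<close>
  define T where "T g x = exp (- M (max 0 x)) * integral {0..max 0 x} (F g)" for g x
  have Mcont: "continuous_on {0..} M"
    by (rule deriv_within_imp_continuous_on) (use M in auto)
  have Lnn: "0 \<le> L t" if "0 \<le> t" for t using bd[OF that, of 0] by linarith
  have Mmono: "M s \<le> M t" if "0 \<le> s" "s \<le> t" for s t
    by (rule deriv_within_nonneg_mono[OF that(2), of "{0..}", OF _ M]) (use that Lnn in auto)
  have Mnn: "0 \<le> M t" if "0 \<le> t" for t using Mmono[of 0 t] M0 that by simp
  have Fcont: "continuous_on {0..} (F g)" if "continuous_on {0..} g" for g
    unfolding F_def
    by (rule continuous_on_compose2[OF cont, of _ "\<lambda>t. (t, y0 + g t * exp (M t))", simplified])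
      (auto intro!: continuous_intros that Mcont)
  have Fint: "F g integrable_on {0..x}" if "continuous_on {0..} g" for g x
    by (rule integrable_continuous_real) (use Fcont[OF that] in \<open>auto intro: continuous_on_subset\<close>)
  have int_exp: "((\<lambda>t. L t * exp (M t)) has_integral (exp (M x) - 1) / 2) {0..x}" if "0 \<le> x" for x
  proof -
    have "((\<lambda>t. L t * exp (M t)) has_integral exp (M x) / 2 - exp (M 0) / 2) {0..x}"
    proof (rule fundamental_theorem_of_calculus[OF that])
      fix t assume "t \<in> {0..x}"
      then have "((\<lambda>t. exp (M t) / 2) has_real_derivative L t * exp (M t)) (at t within {0..})"
        by (auto intro!: derivative_eq_intros M)
      then show "((\<lambda>t. exp (M t) / 2) has_vector_derivative L t * exp (M t)) (at t within {0..x})"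
        by (auto simp flip: has_real_derivative_iff_has_vector_derivative intro: DERIV_subset)
    qed
    then show ?thesis using M0 by (simp add: diff_divide_distrib)
  qed
  have half: "exp (- M x) * (c * ((exp (M x) - 1) / 2)) \<le> c / 2" if "0 \<le> c" for c x
  proof -
    have "exp (- M x) * (c * ((exp (M x) - 1) / 2)) = c / 2 * (1 - exp (- M x))"
      by (simp add: exp_minus field_simps)
    also have "\<dots> \<le> c / 2 * 1" using that by (intro mult_left_mono) auto
    finally show ?thesis by simp
  qed
  have Tbound: "\<bar>T g x\<bar> \<le> 1 / 2" if "continuous_on {0..} g" for g x
  proof -
    let ?x = "max 0 x"
    have "norm (integral {0..?x} (F g)) \<le> integral {0..?x} (\<lambda>t. L t * exp (M t))"
    proof (rule integral_norm_bound_integral[OF Fint[OF that]])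
      show "(\<lambda>t. L t * exp (M t)) integrable_on {0..?x}" using int_exp[of ?x] by (auto simp: integrable_on_def)
      fix t assume "t \<in> {0..?x}"
      then have "\<bar>F g t\<bar> \<le> L t * 1" "L t * 1 \<le> L t * exp (M t)"
        using bd[of t] mult_left_mono[of 1 "exp (M t)" "L t"] Lnn[of t] Mnn[of t]
        by (auto simp: F_def)
      then show "norm (F g t) \<le> L t * exp (M t)" by simp
    qed
    also have "\<dots> = (exp (M ?x) - 1) / 2" using int_exp[of ?x] by (simp add: integral_unique)
    finally have "\<bar>T g x\<bar> \<le> exp (- M ?x) * (1 * ((exp (M ?x) - 1) / 2))"
      unfolding T_def abs_mult by (intro mult_mono) auto
    also have "\<dots> \<le> 1 / 2" by (rule half) simp
    finally show ?thesis .
  qed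
  have Tcont: "continuous_on UNIV (T g)" if "continuous_on {0..} g" for g
  proof -
    have "continuous_on {0..} (\<lambda>x. integral {0..x} (F g))"
      by (rule deriv_within_imp_continuous_on, rule integral_has_real_derivative_atLeast)
        (use Fcont[OF that] in auto)
    then have "continuous_on {0..} (\<lambda>x. exp (- M x) * integral {0..x} (F g))"
      by (intro continuous_intros Mcont)
    then show ?thesis unfolding T_def
      by (rule continuous_on_compose2[of _ _ UNIV "\<lambda>x. max 0 x"]) (auto intro!: continuous_intros)
  qed
  define TT where "TT g = Bcontfun (T (apply_bcontfun g))" for g :: "real \<Rightarrow>\<^sub>C real"
  have TT: "apply_bcontfun (TT g) = T (apply_bcontfun g)" for g
    unfolding TT_def
    by (rule Bcontfun_inverse, rule bcontfun_normI[OF Tcont]) (auto intro!: Tbound)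
  have "\<exists>!g. TT g = g"
  proof (rule banach_fix_type[of "1/2"]; (intro allI)?)
    fix g h :: "real \<Rightarrow>\<^sub>C real"
    show "dist (TT g) (TT h) \<le> 1 / 2 * dist g h"
    proof (rule dist_bound)
      fix x :: real
      let ?x = "max 0 x"
      have "norm (integral {0..?x} (\<lambda>t. F g t - F h t))
          \<le> integral {0..?x} (\<lambda>t. dist g h * (L t * exp (M t)))"
      proof (rule integral_norm_bound_integral)
        show "(\<lambda>t. F g t - F h t) integrable_on {0..?x}"
          by (intro integrable_diff Fint) auto
        show "(\<lambda>t. dist g h * (L t * exp (M t))) integrable_on {0..?x}"
          using has_integral_mult_right[OF int_exp[of ?x]] by (auto simp: integrable_on_def)
        fix t assume t: "t \<in> {0..?x}"
        have "\<bar>F g t - F h t\<bar> \<le> L t * \<bar>(y0 + g t * exp (M t)) - (y0 + h t * exp (M t))\<bar>"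
          unfolding F_def by (rule lip) (use t in auto)
        also have "\<dots> = L t * (dist (g t) (h t) * exp (M t))"
          by (simp add: dist_real_def abs_mult flip: left_diff_distrib)
        also have "\<dots> \<le> L t * (dist g h * exp (M t))"
          using t Lnn[of t] by (intro mult_left_mono mult_right_mono dist_bounded) auto
        finally show "norm (F g t - F h t) \<le> dist g h * (L t * exp (M t))"
          by (simp add: mult_ac)
      qed
      also have "\<dots> = dist g h * ((exp (M ?x) - 1) / 2)"
        using int_exp[of ?x] by (simp add: integral_unique)
      finally have *: "\<bar>integral {0..?x} (F g) - integral {0..?x} (F h)\<bar> \<le> dist g h * ((exp (M ?x) - 1) / 2)"
        by (simp add: integral_diff Fint)
      have "dist (TT g x) (TT h x) = exp (- M ?x) * \<bar>integral {0..?x} (F g) - integral {0..?x} (F h)\<bar>"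
        by (simp add: TT T_def dist_real_def abs_mult flip: right_diff_distrib)
      also have "\<dots> \<le> exp (- M ?x) * (dist g h * ((exp (M ?x) - 1) / 2))"
        using * by (intro mult_left_mono) auto
      also have "\<dots> \<le> dist g h / 2" by (rule half) simp
      finally show "dist (TT g x) (TT h x) \<le> 1 / 2 * dist g h" by simp
    qed
  qed auto
  then obtain g where "TT g = g" by auto
  then have g: "apply_bcontfun g x = T g x" for x using TT[of g] by simp
  define y where "y x = y0 + integral {0..x} (F g)" for x
  have yg: "y x = y0 + g x * exp (M x)" if "0 \<le> x" for x
    using that by (subst g) (simp add: y_def T_def exp_minus field_simps)
  show ?thesis
  proof
    show "y 0 = y0" by (simp add: y_def)
    fix t :: real assume t: "0 \<le> t"
    have "(y has_real_derivative 0 + F g t) (at t within {0..})"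
      unfolding y_def
      by (intro derivative_intros integral_has_real_derivative_atLeast Fcont t) auto
    then show "(y has_real_derivative f t (y t)) (at t within {0..})"
      by (simp add: F_def yg[OF t])
  qed
qed

subsection \<open>Absolutely continuous functions and improper integrals\<close>

text \<open>Over an equidistant partition finer than \<open>d\<close> the bounds telescope to
  \<open>e * (A X - A 0)\<close>, and \<open>e\<close> is arbitrary.\<close>

lemma eq_of_small_increments:
  fixes D A :: "real \<Rightarrow> real"
  assumes "0 \<le> X"
    and small: "\<And>e. 0 < e \<Longrightarrow> \<exists>d>0. \<forall>a b. 0 \<le> a \<longrightarrow> a \<le> b \<longrightarrow> b \<le> X \<longrightarrow> b - a < d \<longrightarrow>
                  \<bar>D b - D a\<bar> \<le> e * (A b - A a)"
  shows "D X = D 0"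
proof -
  have bound: "\<bar>D X - D 0\<bar> \<le> e * (A X - A 0)" if e: "0 < e" for e
  proof -
    obtain d where "d > 0" and d: "\<And>a b. 0 \<le> a \<Longrightarrow> a \<le> b \<Longrightarrow> b \<le> X \<Longrightarrow> b - a < d \<Longrightarrow>
        \<bar>D b - D a\<bar> \<le> e * (A b - A a)"
      using small[OF e] by blast
    obtain n :: nat where n: "X / d < real n" using reals_Archimedean2 by blast
    have n0: "0 < real n" using n \<open>0 \<le> X\<close> \<open>d > 0\<close>
      by (metis divide_nonneg_pos order_le_less_trans)
    have step: "X / n < d" using n n0 \<open>d > 0\<close> by (simp add: field_simps)
    have "\<bar>D (i * (X / n)) - D 0\<bar> \<le> e * (A (i * (X / n)) - A 0)" if "i \<le> n" for i :: nat
      using that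
    proof (induction i)
      case (Suc i)
      have "\<bar>D (Suc i * (X / n)) - D (i * (X / n))\<bar> \<le> e * (A (Suc i * (X / n)) - A (i * (X / n)))"
      proof (rule d)
        have "real (Suc i) * (X / n) \<le> real n * (X / n)"
          using Suc.prems \<open>0 \<le> X\<close> by (intro mult_right_mono) auto
        then show "real (Suc i) * (X / n) \<le> X" using n0 by simp
      qed (use step \<open>0 \<le> X\<close> in \<open>auto simp: algebra_simps add_divide_distrib\<close>)
      then show ?case using Suc by (simp add: algebra_simps)
    qed simp
    from this[of n] show ?thesis using n0 by simp
  qed
  have "0 \<le> A X - A 0" using bound[of 1] by simp
  have "\<bar>D X - D 0\<bar> \<le> 0"
  proof (rule field_le_epsilon)
    fix e :: real assume "0 < e"
    have "\<bar>D X - D 0\<bar> \<le> e / (A X - A 0 + 1) * (A X - A 0)"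
      by (rule bound) (use \<open>0 < e\<close> \<open>0 \<le> A X - A 0\<close> in auto)
    also have "\<dots> \<le> e" using \<open>0 < e\<close> \<open>0 \<le> A X - A 0\<close> by (simp add: field_simps)
    finally show "\<bar>D X - D 0\<bar> \<le> 0 + e" by simp
  qed
  then show ?thesis by simp
qed

lemma loc_AC_deriv_absolutely_integrable:
  assumes "loc_AC_deriv f g" "0 \<le> a"
  shows "g absolutely_integrable_on {a..b}"
proof (cases "a \<le> b")
  case True
  have "g absolutely_integrable_on {0..b}" using assms True by (auto simp: loc_AC_deriv_def)
  then show ?thesis
    using assms(2) by (rule_tac absolutely_integrable_on_subinterval) auto
qed auto

lemma loc_AC_deriv_eq:
  assumes "loc_AC_deriv f g" "0 \<le> x"
  shows "f x = f 0 + integral {0..x} g"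
  using assms unfolding loc_AC_deriv_def by blast

lemma loc_AC_deriv_diff:
  assumes "loc_AC_deriv f g" "0 \<le> a" "a \<le> b"
  shows "f b - f a = integral {a..b} g"
proof -
  have "g integrable_on {0..b}"
    using loc_AC_deriv_absolutely_integrable[OF assms(1), of 0 b] absolutely_integrable_on_def by blast
  then have "integral {0..a} g + integral {a..b} g = integral {0..b} g"
    using assms by (intro Henstock_Kurzweil_Integration.integral_combine) auto
  moreover have "f a = f 0 + integral {0..a} g" "f b = f 0 + integral {0..b} g"
    using assms by (auto intro!: loc_AC_deriv_eq)
  ultimately show ?thesis by simp
qed

lemma loc_AC_deriv_continuous_on:
  assumes "loc_AC_deriv f g"
  shows "continuous_on {0..} f"
proof (rule continuous_on_eq[of _ "\<lambda>x. f 0 + integral {0..x} g"])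
  have "continuous_on {0..b} (\<lambda>x. integral {0..x} g)" for b
    using loc_AC_deriv_absolutely_integrable[OF assms, of 0 b] absolutely_integrable_on_def
    by (intro indefinite_integral_continuous_1) blast
  then have "continuous (at x within {0..}) (\<lambda>x. integral {0..x} g)" if "0 \<le> x" for x
  proof -
    have "continuous (at x within {0..x+1}) (\<lambda>x. integral {0..x} g)"
      using \<open>\<And>b. continuous_on {0..b} (\<lambda>x. integral {0..x} g)\<close>[of "x+1"] that
      by (auto simp: continuous_on_eq_continuous_within)
    moreover have "at x within {0..x+1} = at x within {0..}"
      by (rule at_within_nhd[of _ "{..<x+1}"]) auto
    ultimately show ?thesis by simp
  qed
  then show "continuous_on {0..} (\<lambda>x. f 0 + integral {0..x} g)"
    by (intro continuous_intros) (auto simp: continuous_on_eq_continuous_within)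
  show "f 0 + integral {0..x} g = f x" if "x \<in> {0..}" for x
    using loc_AC_deriv_eq[OF assms, of x] that by simp
qed

lemma absolutely_integrable_continuous_mult:
  fixes f g :: "real \<Rightarrow> real"
  assumes "continuous_on {a..b} f" "g absolutely_integrable_on {a..b}"
  shows "(\<lambda>x. f x * g x) absolutely_integrable_on {a..b}"
  by (rule absolutely_integrable_bounded_measurable_product_real[OF _ _ _ assms(2)])
    (auto intro!: continuous_imp_measurable_on_sets_lebesgue assms compact_imp_bounded
       compact_continuous_image)

lemma absolutely_integrable_on_realD:
  fixes f :: "real \<Rightarrow> real"
  assumes "f absolutely_integrable_on S"
  shows "f integrable_on S" "(\<lambda>x. \<bar>f x\<bar>) integrable_on S"
  using assms by (auto simp: absolutely_integrable_on_def)

text \<open>On a short interval the increment of \<open>f * g\<close> differs from the integral of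
  the candidate density by the integral of \<open>f' t * (g b - g t) + (f a - f t) * g' t\<close>.
  Uniform continuity of \<open>f\<close> and \<open>g\<close> makes this at most \<open>e\<close>
  times the integral of \<open>\<bar>f'\<bar> + \<bar>g'\<bar>\<close>, so no pointwise
  differentiation is involved.\<close>

lemma loc_AC_deriv_mult:
  assumes f: "loc_AC_deriv f f'" and g: "loc_AC_deriv g g'"
  shows "loc_AC_deriv (\<lambda>x. f x * g x) (\<lambda>x. f' x * g x + f x * g' x)"
  unfolding loc_AC_deriv_def
proof (intro allI impI conjI)
  fix X :: real assume X: "0 \<le> X"
  let ?h = "\<lambda>x. f' x * g x + f x * g' x"
  have contf: "continuous_on {a..b} f" and contg: "continuous_on {a..b} g" if "0 \<le> a" for a b
    using loc_AC_deriv_continuous_on[OF f] loc_AC_deriv_continuous_on[OF g] that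
    by (auto intro: continuous_on_subset)
  have intf: "f' absolutely_integrable_on {a..b}" and intg: "g' absolutely_integrable_on {a..b}"
    if "0 \<le> a" for a b
    using loc_AC_deriv_absolutely_integrable f g that by blast+
  have inth: "?h absolutely_integrable_on {a..b}" if "0 \<le> a" for a b
    using absolutely_integrable_continuous_mult[OF contg[OF that] intf[OF that], of b]
      absolutely_integrable_continuous_mult[OF contf[OF that] intg[OF that], of b]
    by (intro set_integral_add) (simp_all only: mult.commute)
  then show "?h absolutely_integrable_on {0..X}" by blast
  define A where "A x = integral {0..x} (\<lambda>x. \<bar>f' x\<bar> + \<bar>g' x\<bar>)" for x
  define D where "D x = f x * g x - integral {0..x} ?h" for x
  have "D X = D 0"
  proof (rule eq_of_small_increments[where A=A, OF X])
    fix e :: real assume "0 < e"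
    have "uniformly_continuous_on {0..X} f" "uniformly_continuous_on {0..X} g"
      by (auto intro!: compact_uniformly_continuous contf contg)
    then obtain d1 d2 where "0 < d1" "0 < d2"
      and d1: "\<And>s t. s \<in> {0..X} \<Longrightarrow> t \<in> {0..X} \<Longrightarrow> dist s t < d1 \<Longrightarrow> dist (f s) (f t) < e"
      and d2: "\<And>s t. s \<in> {0..X} \<Longrightarrow> t \<in> {0..X} \<Longrightarrow> dist s t < d2 \<Longrightarrow> dist (g s) (g t) < e"
      using \<open>0 < e\<close> unfolding uniformly_continuous_on_def by metis
    show "\<exists>d>0. \<forall>a b. 0 \<le> a \<longrightarrow> a \<le> b \<longrightarrow> b \<le> X \<longrightarrow> b - a < d \<longrightarrow> \<bar>D b - D a\<bar> \<le> e * (A b - A a)"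
    proof (intro exI[of _ "min d1 d2"] conjI allI impI)
      fix a b :: real assume ab: "0 \<le> a" "a \<le> b" "b \<le> X" "b - a < min d1 d2"
      have abs_int: "(\<lambda>x. \<bar>f' x\<bar> + \<bar>g' x\<bar>) integrable_on {c..b}" if "0 \<le> c" for c
        by (intro integrable_add absolutely_integrable_on_realD(2)[OF intf]
            absolutely_integrable_on_realD(2)[OF intg] that)
      have "integral {0..a} ?h + integral {a..b} ?h = integral {0..b} ?h"
        by (intro Henstock_Kurzweil_Integration.integral_combine ab
            absolutely_integrable_on_realD(1)[OF inth]) simp
      then have "D b - D a = (f b - f a) * g b + f a * (g b - g a) - integral {a..b} ?h"
        by (simp add: D_def algebra_simps)
      also have "\<dots> = integral {a..b} (\<lambda>t. f' t * g b) + integral {a..b} (\<lambda>t. f a * g' t)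
           - integral {a..b} ?h"
        using loc_AC_deriv_diff[OF f ab(1,2)] loc_AC_deriv_diff[OF g ab(1,2)] by simp
      also have "\<dots> = integral {a..b} (\<lambda>t. f' t * g b + f a * g' t - ?h t)"
      proof -
        have 1: "(\<lambda>t. f' t * g b) integrable_on {a..b}"
          by (intro integrable_on_mult_left absolutely_integrable_on_realD(1)[OF intf] ab)
        have 2: "(\<lambda>t. f a * g' t) integrable_on {a..b}"
          by (intro integrable_on_mult_right absolutely_integrable_on_realD(1)[OF intg] ab)
        have 3: "?h integrable_on {a..b}" by (intro absolutely_integrable_on_realD(1)[OF inth] ab)
        show ?thesis
          using integral_diff[OF integrable_add[OF 1 2] 3] integral_add[OF 1 2] by simp
      qed
      finally have D: "D b - D a = integral {a..b} (\<lambda>t. f' t * (g b - g t) + (f a - f t) * g' t)"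
        by (simp add: algebra_simps)
      have "norm (integral {a..b} (\<lambda>t. f' t * (g b - g t) + (f a - f t) * g' t))
          \<le> integral {a..b} (\<lambda>t. e * (\<bar>f' t\<bar> + \<bar>g' t\<bar>))"
      proof (rule integral_norm_bound_integral)
        have "(\<lambda>t. (g b - g t) * f' t) absolutely_integrable_on {a..b}"
             "(\<lambda>t. (f a - f t) * g' t) absolutely_integrable_on {a..b}"
          by (intro absolutely_integrable_continuous_mult continuous_intros contf contg intf intg ab)+
        then show "(\<lambda>t. f' t * (g b - g t) + (f a - f t) * g' t) integrable_on {a..b}"
          by (intro integrable_add absolutely_integrable_on_realD(1)) (simp_all only: mult.commute)
        show "(\<lambda>t. e * (\<bar>f' t\<bar> + \<bar>g' t\<bar>)) integrable_on {a..b}"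
          by (intro integrable_on_mult_right abs_int ab)
        fix t assume t: "t \<in> {a..b}"
        have "\<bar>g b - g t\<bar> \<le> e" "\<bar>f a - f t\<bar> \<le> e"
          using d1[of a t] d2[of b t] t ab by (auto simp: dist_real_def)
        then have "\<bar>f' t * (g b - g t)\<bar> \<le> \<bar>f' t\<bar> * e" "\<bar>(f a - f t) * g' t\<bar> \<le> e * \<bar>g' t\<bar>"
          unfolding abs_mult by (auto intro: mult_left_mono mult_right_mono)
        then show "norm (f' t * (g b - g t) + (f a - f t) * g' t) \<le> e * (\<bar>f' t\<bar> + \<bar>g' t\<bar>)"
          by (simp add: algebra_simps)
      qed
      also have "\<dots> = e * (A b - A a)"
        using Henstock_Kurzweil_Integration.integral_combine[OF ab(1,2) abs_int] by (simp add: A_def)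
      finally show "\<bar>D b - D a\<bar> \<le> e * (A b - A a)" by (simp add: D)
    qed (use \<open>0 < d1\<close> \<open>0 < d2\<close> in auto)
  qed
  then show "f X * g X = f 0 * g 0 + integral {0..X} ?h"
    by (simp add: D_def)
qed

lemma loc_AC_deriv_add:
  assumes "loc_AC_deriv f f'" "loc_AC_deriv g g'"
  shows "loc_AC_deriv (\<lambda>x. f x + g x) (\<lambda>x. f' x + g' x)"
  unfolding loc_AC_deriv_def
proof (intro allI impI conjI)
  fix x :: real assume x: "0 \<le> x"
  note int = assms[THEN loc_AC_deriv_absolutely_integrable, of 0 x, OF order_refl]
  show "(\<lambda>x. f' x + g' x) absolutely_integrable_on {0..x}"
    by (rule set_integral_add(1)[OF int])
  show "f x + g x = f 0 + g 0 + integral {0..x} (\<lambda>x. f' x + g' x)"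
    using loc_AC_deriv_diff[OF assms(1) order_refl x] loc_AC_deriv_diff[OF assms(2) order_refl x]
    by (simp add: integral_add absolutely_integrable_on_realD int)
qed

lemma loc_AC_deriv_diff_fun:
  assumes "loc_AC_deriv f f'" "loc_AC_deriv g g'"
  shows "loc_AC_deriv (\<lambda>x. f x - g x) (\<lambda>x. f' x - g' x)"
  unfolding loc_AC_deriv_def
proof (intro allI impI conjI)
  fix x :: real assume x: "0 \<le> x"
  note int = assms[THEN loc_AC_deriv_absolutely_integrable, of 0 x, OF order_refl]
  show "(\<lambda>x. f' x - g' x) absolutely_integrable_on {0..x}"
    by (rule set_integral_diff(1)[OF int])
  show "f x - g x = f 0 - g 0 + integral {0..x} (\<lambda>x. f' x - g' x)"
    using loc_AC_deriv_diff[OF assms(1) order_refl x] loc_AC_deriv_diff[OF assms(2) order_refl x]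
    by (simp add: integral_diff absolutely_integrable_on_realD int)
qed

text \<open>Lets an equation that holds almost everywhere replace one density by another, in
  particular by a continuous one free of \<open>q\<close>.\<close>

lemma loc_AC_deriv_cong_AE:
  assumes f: "loc_AC_deriv f g" and ae: "AE x in lebesgue. 0 \<le> x \<longrightarrow> g x = h x"
  shows "loc_AC_deriv f h"
proof -
  obtain N where N: "negligible N" "\<And>x. x \<notin> N \<Longrightarrow> 0 \<le> x \<Longrightarrow> g x = h x"
    using ae unfolding eventually_ae_filter_negligible by blast
  have "h absolutely_integrable_on {0..x}" "integral {0..x} g = integral {0..x} h" if "0 \<le> x" for x
  proof -
    show "h absolutely_integrable_on {0..x}"
      by (rule absolutely_integrable_spike[OF loc_AC_deriv_absolutely_integrable[OF f order_refl] N(1)])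
        (use N(2) in force)
    show "integral {0..x} g = integral {0..x} h"
      by (rule integral_spike[OF N(1)]) (use N(2) in force)
  qed
  then show ?thesis
    unfolding loc_AC_deriv_def using loc_AC_deriv_eq[OF f] by metis
qed

lemma loc_AC_deriv_of_C1:
  assumes der: "\<And>x. 0 \<le> x \<Longrightarrow> (f has_real_derivative g x) (at x within {0..})"
    and cont: "continuous_on {0..} g"
  shows "loc_AC_deriv f g"
  unfolding loc_AC_deriv_def
proof (intro allI impI conjI)
  fix x :: real assume x: "0 \<le> x"
  show "g absolutely_integrable_on {0..x}"
    by (rule absolutely_integrable_continuous_real) (use cont in \<open>auto intro: continuous_on_subset\<close>)
  have "(g has_integral f x - f 0) {0..x}"
  proof (rule fundamental_theorem_of_calculus[OF x])
    fix t assume "t \<in> {0..x}"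
    then have "(f has_real_derivative g t) (at t within {0..x})"
      using DERIV_subset[OF der[of t]] by auto
    then show "(f has_vector_derivative g t) (at t within {0..x})"
      by (simp flip: has_real_derivative_iff_has_vector_derivative)
  qed
  then show "f x = f 0 + integral {0..x} g" by (simp add: integral_unique)
qed

lemma loc_AC_deriv_has_real_derivative:
  assumes f: "loc_AC_deriv f g" and cont: "continuous_on {0..} g" and x: "0 \<le> x"
  shows "(f has_real_derivative g x) (at x within {0..})"
proof (rule has_field_derivative_transform_within[where f="\<lambda>x. f 0 + integral {0..x} g" and d=1])
  have "((\<lambda>x. f 0 + integral {0..x} g) has_real_derivative 0 + g x) (at x within {0..})"
    by (intro derivative_intros integral_has_real_derivative_atLeast cont x) 
  then show "((\<lambda>x. f 0 + integral {0..x} g) has_real_derivative g x) (at x within {0..})"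
    by simp
  show "f 0 + integral {0..y} g = f y" if "y \<in> {0..}" for y
    using loc_AC_deriv_eq[OF f, of y] that by simp
qed (use x in auto)

section \<open>Improper integrals of nonnegative functions\<close>

lemma nonneg_continuous_has_integral_atLeast:
  fixes f :: "real \<Rightarrow> real"
  assumes cont: "continuous_on {0..} f" and nonneg: "\<And>x. 0 \<le> x \<Longrightarrow> 0 \<le> f x"
    and bd: "\<And>x. 0 \<le> x \<Longrightarrow> integral {0..x} f \<le> B"
  obtains I where "(f has_integral I) {0..}" "((\<lambda>x. integral {0..x} f) \<longlongrightarrow> I) at_top"
proof
  have int: "f integrable_on {0..x}" for x
    by (rule integrable_continuous_real) (use cont in \<open>auto intro: continuous_on_subset\<close>)
  let ?I = "SUP x\<in>{0..}. integral {0..x} f"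
  have bdd: "bdd_above ((\<lambda>x. integral {0..x} f) ` {0..})" by (rule bdd_aboveI2[of _ _ B]) (use bd in auto)
  show lim: "((\<lambda>x. integral {0..x} f) \<longlongrightarrow> ?I) at_top"
  proof (rule increasing_tendsto)
    show "\<forall>\<^sub>F x in at_top. integral {0..x} f \<le> ?I"
      using eventually_ge_at_top[of 0] by eventually_elim (auto intro!: cSUP_upper bdd)
    fix l assume "l < ?I"
    then obtain x where x: "0 \<le> x" "l < integral {0..x} f"
      using less_cSUP_iff[OF _ bdd] by auto
    show "\<forall>\<^sub>F y in at_top. l < integral {0..y} f"
      using eventually_ge_at_top[of x]
    proof eventually_elim
      case (elim y)
      have "integral {0..x} f \<le> integral {0..y} f"
        by (rule integral_subset_le) (use elim int nonneg in auto)
      then show ?case using x by simp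
    qed
  qed
  show "(f has_integral ?I) {0..}"
    by (rule has_integral_to_inf[OF int lim nonneg])
qed

lemma integral_le_integral_atLeast:
  fixes f :: "real \<Rightarrow> real"
  assumes "f integrable_on {0..}" "\<And>x. 0 \<le> x \<Longrightarrow> 0 \<le> f x" "0 \<le> a"
  shows "integral {a..b} f \<le> integral {0..} f"
proof (rule integral_subset_le)
  show "f integrable_on {a..b}"
    using integrable_on_subinterval[OF assms(1), of a b] assms(3) by auto
qed (use assms in auto)

text \<open>A bounded integral gives no limit of \<open>f\<close>, but it does give small values
  arbitrarily far out; each application needs only one such point.\<close>

lemma small_value_of_bounded_integral:
  fixes f :: "real \<Rightarrow> real"
  assumes cont: "continuous_on {a..} f"
    and bd: "\<And>x. a \<le> x \<Longrightarrow> integral {a..x} f \<le> B" and nonneg: "\<And>x. a \<le> x \<Longrightarrow> 0 \<le> f x"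
    and "0 < e"
  shows "\<exists>x\<ge>a. y \<le> x \<and> f x < e"
proof (rule ccontr)
  assume "\<not> ?thesis"
  then have ge: "e \<le> f x" if "a \<le> x" "y \<le> x" for x using that by force
  have int: "f integrable_on {b..x}" if "a \<le> b" for b x
    by (rule integrable_continuous_real) (use cont that in \<open>auto intro: continuous_on_subset\<close>)
  define z where "z = max a y"
  \<comment> \<open>Far enough that the constant \<open>e\<close> alone integrates to
    \<open>\<bar>B\<bar> + e\<close> over \<open>{z..x}\<close>.\<close>
  define x where "x = z + \<bar>B\<bar> / e + 1"
  have "0 \<le> \<bar>B\<bar> / e" using \<open>0 < e\<close> by simp
  then have zx: "a \<le> z" "z \<le> x" "y \<le> z" by (auto simp: z_def x_def)
  have "e * (x - z) = integral {z..x} (\<lambda>_. e)" using zx by simp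
  also have "\<dots> \<le> integral {z..x} f"
    by (rule integral_le) (use zx ge int in auto)
  also have "\<dots> \<le> integral {a..x} f"
    by (rule integral_subset_le) (use zx nonneg int in auto)
  also have "\<dots> \<le> B" using bd zx by simp
  finally have "e * (x - z) \<le> B" .
  moreover have "e * (x - z) = \<bar>B\<bar> + e" using \<open>0 < e\<close> by (simp add: x_def field_simps)
  ultimately show False using \<open>0 < e\<close> by linarith
qed

lemma continuous_integrable_Icc:
  fixes f :: "real \<Rightarrow> real"
  assumes "continuous_on {0..} f" "0 \<le> a"
  shows "f integrable_on {a..b}"
  by (rule integrable_continuous_real) (use assms in \<open>auto intro: continuous_on_subset\<close>)

subsection \<open>Elementary inequalities and trigonometry\<close>

lemma abs_mult_le_sum_squares: "\<bar>a * b\<bar> \<le> a\<^sup>2 + b\<^sup>2" for a b :: real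
proof -
  have "(\<bar>a\<bar> - \<bar>b\<bar>)\<^sup>2 = a\<^sup>2 + b\<^sup>2 - 2 * \<bar>a * b\<bar>" by (simp add: power2_diff abs_mult)
  then show ?thesis using zero_le_power2[of "\<bar>a\<bar> - \<bar>b\<bar>"] abs_ge_zero[of "a * b"] by linarith
qed

lemma abs_sin_diff_le: "\<bar>sin x - sin y\<bar> \<le> \<bar>x - y\<bar>" for x y :: real
proof -
  have *: "\<bar>sin b - sin a\<bar> \<le> 1 * (b - a)" if "a \<le> b" for a b :: real
    by (rule deriv_within_abs_diff_le[OF that, of UNIV _ cos])
      (auto intro!: derivative_eq_intros)
  show ?thesis using *[of x y] *[of y x] by (cases "x \<le> y") (auto simp: abs_minus_commute)
qed

lemma abs_cos_diff_le: "\<bar>cos x - cos y\<bar> \<le> \<bar>x - y\<bar>" for x y :: real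
  using abs_sin_diff_le[of "x + pi/2" "y + pi/2"] by (simp add: sin_add)

lemma sin_cos_add_nat_pi: "sin (z + real n * pi) * cos (z + real n * pi) = sin z * cos z"
proof -
  have "sin (z + real n * pi) * cos (z + real n * pi) = sin z * cos z * ((- 1) ^ n * (- 1) ^ n)"
    by (simp add: sin_add cos_add)
  also have "(- 1 :: real) ^ n * (- 1) ^ n = 1"
    by (simp flip: power_mult_distrib)
  finally show ?thesis by simp
qed

lemma sin_cos_nonneg_first_quadrant:
  "real m * pi \<le> y \<Longrightarrow> y \<le> (real m + 1/2) * pi \<Longrightarrow> 0 \<le> sin y * cos y"
  using sin_cos_add_nat_pi[of "y - real m * pi" m]
    mult_nonneg_nonneg[OF sin_ge_zero[of "y - real m * pi"] cos_ge_zero[of "y - real m * pi"]]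
  by (simp add: algebra_simps)

lemma sin_cos_nonpos_second_quadrant:
  "(real m + 1/2) * pi \<le> y \<Longrightarrow> y \<le> (real m + 1) * pi \<Longrightarrow> sin y * cos y \<le> 0"
  using sin_cos_nonneg_first_quadrant[of m "y - pi/2"]
  by (simp add: algebra_simps sin_diff cos_diff)

lemma sin_mult_sin_pos:
  assumes "real m * pi < y" "y < (real m + 1) * pi" "real m * pi < z" "z < (real m + 1) * pi"
  shows "0 < sin y * sin z"
proof -
  have "0 < sin (y - real m * pi) * sin (z - real m * pi)"
    using assms by (intro mult_pos_pos sin_gt_zero) (auto simp: algebra_simps)
  also have "\<dots> = sin y * sin z * ((- 1) ^ m * (- 1) ^ m)" by (simp add: sin_diff)
  also have "(- 1 :: real) ^ m * (- 1) ^ m = 1" by (simp flip: power_mult_distrib)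
  finally show ?thesis by simp
qed

text \<open>The arctan term is the angle from \<open>(sin th, cos th)\<close> to
  \<open>(s * sin th, cos th)\<close>: its argument is the tangent of the difference of the two
  angles. The denominator is positive, so the rescaled angle is differentiable without any choice of
  branches.\<close>

lemma arctan_angle_deriv:
  fixes th s :: "real \<Rightarrow> real"
  assumes th: "(th has_real_derivative t) (at x within A)"
    and s: "(s has_real_derivative s') (at x within A)" and pos: "0 < s x"
  shows "((\<lambda>x. th x + arctan ((s x - 1) * (sin (th x) * cos (th x)) / ((cos (th x))\<^sup>2 + s x * (sin (th x))\<^sup>2)))
    has_real_derivative (s x * t + sin (th x) * cos (th x) * s') / ((cos (th x))\<^sup>2 + (s x)\<^sup>2 * (sin (th x))\<^sup>2))
    (at x within A)"
proof -
  define S where "S = sin (th x)"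
  define C where "C = cos (th x)"
  define D where "D = C\<^sup>2 + s x * S\<^sup>2"
  define N where "N = (s x - 1) * (S * C)"
  define N' where "N' = s' * (S * C) + (s x - 1) * (C * t * C + S * (- S * t))"
  define D' where "D' = 2 * C * (- S * t) + (s' * S\<^sup>2 + s x * (2 * S * (C * t)))"
  have SC: "S\<^sup>2 + C\<^sup>2 = 1" by (simp add: S_def C_def)
  \<comment> \<open>Squared moduli in \<open>D + i N = (C - i S) * (C + i s S)\<close>; the first
    factor has modulus \<open>1\<close>.\<close>
  have E: "D\<^sup>2 + N\<^sup>2 = C\<^sup>2 + (s x)\<^sup>2 * S\<^sup>2"
    using SC unfolding D_def N_def by algebra
  have key: "t * (C\<^sup>2 + (s x)\<^sup>2 * S\<^sup>2) + (N' * D - N * D') = s x * t + S * C * s'"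
    using SC unfolding D_def N_def N'_def D'_def by algebra
  have "0 < D"
  proof (cases "S = 0")
    case True
    then show ?thesis using SC by (simp add: D_def)
  next
    case False
    then show ?thesis using pos by (simp add: D_def add_nonneg_pos)
  qed
  have Epos: "0 < D\<^sup>2 + N\<^sup>2" using \<open>0 < D\<close> by (simp add: add_pos_nonneg)
  have dsin: "((\<lambda>x. sin (th x)) has_real_derivative C * t) (at x within A)"
    and dcos: "((\<lambda>x. cos (th x)) has_real_derivative - S * t) (at x within A)"
    using DERIV_chain2[OF DERIV_sin th] DERIV_chain2[OF DERIV_cos th] by (simp_all add: S_def C_def)
  have dN: "((\<lambda>x. (s x - 1) * (sin (th x) * cos (th x))) has_real_derivative N') (at x within A)"
    by (rule derivative_eq_intros dsin dcos s refl)+ (simp add: N'_def S_def C_def algebra_simps)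
  have dD: "((\<lambda>x. (cos (th x))\<^sup>2 + s x * (sin (th x))\<^sup>2) has_real_derivative D') (at x within A)"
    by (rule derivative_eq_intros dsin dcos s refl)+ (simp add: D'_def S_def C_def algebra_simps)
  have "((\<lambda>x. (s x - 1) * (sin (th x) * cos (th x)) / ((cos (th x))\<^sup>2 + s x * (sin (th x))\<^sup>2))
      has_real_derivative (N' * D - N * D') / (D * D)) (at x within A)"
    using DERIV_divide[OF dN dD] \<open>0 < D\<close> by (simp add: D_def N_def S_def C_def)
  from DERIV_chain2[OF DERIV_arctan this]
  have dA: "((\<lambda>x. arctan ((s x - 1) * (sin (th x) * cos (th x)) / ((cos (th x))\<^sup>2 + s x * (sin (th x))\<^sup>2)))
      has_real_derivative inverse (1 + (N / D)\<^sup>2) * ((N' * D - N * D') / (D * D))) (at x within A)"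
    by (simp add: D_def N_def S_def C_def)
  have inv: "inverse (1 + (N / D)\<^sup>2) * ((N' * D - N * D') / (D * D)) = (N' * D - N * D') / (D\<^sup>2 + N\<^sup>2)"
  proof -
    have "1 + (N / D)\<^sup>2 = (D\<^sup>2 + N\<^sup>2) / (D * D)"
      using \<open>0 < D\<close> by (simp add: field_simps power2_eq_square)
    then show ?thesis using \<open>0 < D\<close> by simp
  qed
  have "t + (N' * D - N * D') / (D\<^sup>2 + N\<^sup>2) = (s x * t + S * C * s') / (C\<^sup>2 + (s x)\<^sup>2 * S\<^sup>2)"
    using key Epos unfolding E by (simp add: field_simps)
  then have "t + inverse (1 + (N / D)\<^sup>2) * ((N' * D - N * D') / (D * D))
      = (s x * t + sin (th x) * cos (th x) * s') / ((cos (th x))\<^sup>2 + (s x)\<^sup>2 * (sin (th x))\<^sup>2)"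
    unfolding inv S_def C_def .
  from DERIV_cong[OF DERIV_add[OF th dA] this] show ?thesis .
qed

subsection \<open>The potential\<close>

locale airy_potential =
  fixes q :: "real \<Rightarrow> real"
  assumes q_int: "q absolutely_integrable_on {0..}"
begin

definition K :: real where "K = integral {0..} (\<lambda>x. \<bar>q x\<bar>)"

definition Q :: "real \<Rightarrow> real" where "Q x = integral {0..x} q"

lemma abs_q_int: "(\<lambda>x. \<bar>q x\<bar>) integrable_on {0..}"
  using absolutely_integrable_on_realD[OF q_int] by simp

lemma q_int_Icc: "0 \<le> a \<Longrightarrow> q absolutely_integrable_on {a..b}"
  using absolutely_integrable_on_subinterval[OF q_int, of a b] by auto

lemma integral_abs_q_le: "0 \<le> a \<Longrightarrow> integral {a..b} (\<lambda>x. \<bar>q x\<bar>) \<le> K"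
  unfolding K_def by (rule integral_le_integral_atLeast[OF abs_q_int]) auto

lemma K_nonneg: "0 \<le> K"
  using integral_abs_q_le[of 0 0] by simp

lemma Q_AC: "loc_AC_deriv Q q"
  unfolding loc_AC_deriv_def Q_def using q_int_Icc by auto

lemma Q_0 [simp]: "Q 0 = 0"
  by (simp add: Q_def)

lemma Q_cont: "continuous_on {0..} Q"
  by (rule loc_AC_deriv_continuous_on[OF Q_AC])

lemma Q_bound: "0 \<le> x \<Longrightarrow> \<bar>Q x\<bar> \<le> K"
proof -
  assume "0 \<le> x"
  have "norm (integral {0..x} q) \<le> integral {0..x} (\<lambda>x. \<bar>q x\<bar>)"
    by (rule integral_norm_bound_integral)
      (use absolutely_integrable_on_realD[OF q_int_Icc[of 0 x]] in auto)
  then show ?thesis using integral_abs_q_le[of 0 x] by (simp add: Q_def)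
qed

lemma Q_power2_bound: "0 \<le> x \<Longrightarrow> (Q x)\<^sup>2 \<le> K\<^sup>2"
  using Q_bound[of x] K_nonneg by (simp add: abs_le_square_iff[symmetric])

lemma abs_q_tail:
  assumes "0 < e"
  obtains R where "0 \<le> R" "\<And>a b. R \<le> a \<Longrightarrow> integral {a..b} (\<lambda>x. \<bar>q x\<bar>) \<le> e"
proof -
  have abs: "(\<lambda>x. \<bar>q x\<bar>) absolutely_integrable_on {0..}"
    using absolutely_integrable_abs[OF q_int] by simp
  have "((\<lambda>b. set_lebesgue_integral lebesgue {0..b} (\<lambda>x. \<bar>q x\<bar>))
      \<longlongrightarrow> set_lebesgue_integral lebesgue {0..} (\<lambda>x. \<bar>q x\<bar>)) at_top"
    by (rule tendsto_set_lebesgue_integral_at_top[OF _ abs]) simp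
  moreover have "set_lebesgue_integral lebesgue {0..} (\<lambda>x. \<bar>q x\<bar>) = K"
    unfolding K_def by (rule set_lebesgue_integral_eq_integral(2)[OF abs])
  moreover have "set_lebesgue_integral lebesgue {0..b} (\<lambda>x. \<bar>q x\<bar>) = integral {0..b} (\<lambda>x. \<bar>q x\<bar>)" for b
    using absolutely_integrable_abs[OF q_int_Icc[of 0 b]]
    by (intro set_lebesgue_integral_eq_integral(2)) simp
  ultimately have "((\<lambda>b. integral {0..b} (\<lambda>x. \<bar>q x\<bar>)) \<longlongrightarrow> K) at_top" by simp
  then have "\<forall>\<^sub>F b in at_top. K - e < integral {0..b} (\<lambda>x. \<bar>q x\<bar>)"
    by (rule order_tendstoD) (use assms in auto)
  then obtain R0 where R0: "\<And>b. R0 \<le> b \<Longrightarrow> K - e < integral {0..b} (\<lambda>x. \<bar>q x\<bar>)"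
    by (auto simp: eventually_at_top_linorder)
  show ?thesis
  proof
    show "0 \<le> max 0 R0" by simp
    fix a b :: real assume a: "max 0 R0 \<le> a"
    show "integral {a..b} (\<lambda>x. \<bar>q x\<bar>) \<le> e"
    proof (cases "a \<le> b")
      case True
      have "integral {0..a} (\<lambda>x. \<bar>q x\<bar>) + integral {a..b} (\<lambda>x. \<bar>q x\<bar>) = integral {0..b} (\<lambda>x. \<bar>q x\<bar>)"
        using absolutely_integrable_on_realD(2)[OF q_int_Icc[of 0 b]] True a
        by (intro Henstock_Kurzweil_Integration.integral_combine) auto
      then show ?thesis using R0[of a] integral_abs_q_le[of 0 b] a by simp
    qed (use assms in auto)
  qed
qed

subsection \<open>Pruefer angle and regularised system\<close>

text \<open>With \<open>u = r * sin y\<close> and \<open>v = r * cos y\<close>, this is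
  \<open>(u' * v - u * v') / r^2\<close> computed from the system.\<close>

definition prufer_rhs :: "real \<Rightarrow> real \<Rightarrow> real \<Rightarrow> real" where
  "prufer_rhs lam x y = (cos y + Q x * sin y)\<^sup>2 + (lam - x) * (sin y)\<^sup>2"

text \<open>Large enough to bound both the slope and its Lipschitz constant, as
  \<open>scalar_ode_exists\<close> demands of one function. It grows with \<open>x\<close>, so its
  value at the right end serves a whole interval.\<close>

definition lip :: "real \<Rightarrow> real \<Rightarrow> real" where
  "lip lam x = 2 * (1 + K)\<^sup>2 + 2 * (\<bar>lam\<bar> + x)"

lemma cos_Q_sin_bound: "0 \<le> x \<Longrightarrow> \<bar>cos y + Q x * sin y\<bar> \<le> 1 + K"
proof -
  assume "0 \<le> x"
  have "\<bar>Q x * sin y\<bar> \<le> K * 1"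
    unfolding abs_mult using Q_bound[OF \<open>0 \<le> x\<close>] K_nonneg by (intro mult_mono) auto
  then show ?thesis using abs_cos_le_one[of y] by linarith
qed

lemma prufer_rhs_lipschitz:
  assumes "0 \<le> x"
  shows "\<bar>prufer_rhs lam x y - prufer_rhs lam x z\<bar> \<le> lip lam x * \<bar>y - z\<bar>"
proof -
  let ?A = "\<lambda>y. cos y + Q x * sin y"
  have "\<bar>Q x * (sin y - sin z)\<bar> \<le> K * \<bar>y - z\<bar>"
    unfolding abs_mult using Q_bound[OF assms] K_nonneg abs_sin_diff_le by (intro mult_mono) auto
  then have A: "\<bar>?A y - ?A z\<bar> \<le> (1 + K) * \<bar>y - z\<bar>"
    using abs_cos_diff_le[of y z] by (simp add: algebra_simps)
  have "\<bar>(?A y)\<^sup>2 - (?A z)\<^sup>2\<bar> = \<bar>?A y + ?A z\<bar> * \<bar>?A y - ?A z\<bar>"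
    by (simp add: power2_eq_square flip: abs_mult) (simp add: algebra_simps)
  also have "\<dots> \<le> (2 * (1 + K)) * ((1 + K) * \<bar>y - z\<bar>)"
    using cos_Q_sin_bound[OF assms, of y] cos_Q_sin_bound[OF assms, of z] A K_nonneg
    by (intro mult_mono) auto
  finally have 1: "\<bar>(?A y)\<^sup>2 - (?A z)\<^sup>2\<bar> \<le> 2 * (1 + K)\<^sup>2 * \<bar>y - z\<bar>"
    by (simp add: power2_eq_square algebra_simps)
  have "\<bar>(sin y)\<^sup>2 - (sin z)\<^sup>2\<bar> = \<bar>sin y + sin z\<bar> * \<bar>sin y - sin z\<bar>"
    by (simp add: power2_eq_square flip: abs_mult) (simp add: algebra_simps)
  also have "\<dots> \<le> 2 * \<bar>y - z\<bar>"
  proof (intro mult_mono abs_sin_diff_le)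
    show "\<bar>sin y + sin z\<bar> \<le> 2"
      using abs_sin_le_one[of y] abs_sin_le_one[of z] by linarith
  qed auto
  finally have "\<bar>lam - x\<bar> * \<bar>(sin y)\<^sup>2 - (sin z)\<^sup>2\<bar> \<le> (\<bar>lam\<bar> + x) * (2 * \<bar>y - z\<bar>)"
    using assms by (intro mult_mono) auto
  then have 2: "\<bar>(lam - x) * (sin y)\<^sup>2 - (lam - x) * (sin z)\<^sup>2\<bar> \<le> 2 * (\<bar>lam\<bar> + x) * \<bar>y - z\<bar>"
    by (simp add: abs_mult flip: right_diff_distrib) (simp add: algebra_simps)
  have "\<bar>prufer_rhs lam x y - prufer_rhs lam x z\<bar>
      \<le> 2 * (1 + K)\<^sup>2 * \<bar>y - z\<bar> + 2 * (\<bar>lam\<bar> + x) * \<bar>y - z\<bar>"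
    using 1 2 unfolding prufer_rhs_def by linarith
  then show ?thesis by (simp add: lip_def algebra_simps)
qed

lemma prufer_rhs_bound:
  assumes "0 \<le> x"
  shows "\<bar>prufer_rhs lam x y\<bar> \<le> (1 + K)\<^sup>2 + \<bar>lam - x\<bar>"
proof -
  have "(cos y + Q x * sin y)\<^sup>2 \<le> (1 + K)\<^sup>2"
    using cos_Q_sin_bound[OF assms, of y] K_nonneg by (simp add: abs_le_square_iff[symmetric])
  moreover have "\<bar>(lam - x) * (sin y)\<^sup>2\<bar> \<le> \<bar>lam - x\<bar> * 1"
    unfolding abs_mult using abs_sin_le_one[of y]
    by (intro mult_mono) (auto simp: abs_square_le_1)
  ultimately show ?thesis unfolding prufer_rhs_def by (smt (verit) zero_le_power2)
qed

lemma prufer_rhs_cont: "continuous_on ({0..} \<times> UNIV) (\<lambda>(x, y). prufer_rhs lam x y)"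
proof -
  have "continuous_on ({0..} \<times> UNIV) (\<lambda>z::real \<times> real. Q (fst z))"
    by (rule continuous_on_compose2[OF Q_cont]) (auto intro!: continuous_intros)
  then show ?thesis
    unfolding prufer_rhs_def case_prod_beta by (intro continuous_intros)
qed

definition theta :: "real \<Rightarrow> real \<Rightarrow> real" where
  "theta lam = (SOME y. y 0 = pi / 2 \<and>
     (\<forall>x\<ge>0. (y has_real_derivative prufer_rhs lam x (y x)) (at x within {0..})))"

lemma theta_0 [simp]: "theta lam 0 = pi / 2"
  and theta_deriv: "0 \<le> x \<Longrightarrow>
    (theta lam has_real_derivative prufer_rhs lam x (theta lam x)) (at x within {0..})"
proof -
  obtain y where "y 0 = pi / 2"
    "\<And>t. 0 \<le> t \<Longrightarrow> (y has_real_derivative prufer_rhs lam t (y t)) (at t within {0..})"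
  proof (rule scalar_ode_exists[OF prufer_rhs_cont prufer_rhs_lipschitz, where ?y0.0 = "pi / 2"])
    fix t y :: real assume t: "0 \<le> t"
    have "0 \<le> (1 + K)\<^sup>2" by simp
    then show "\<bar>prufer_rhs lam t y\<bar> \<le> lip lam t"
      using prufer_rhs_bound[OF t, of lam y] t unfolding lip_def by (smt (verit))
    show "((\<lambda>t. (4 * (1 + K)\<^sup>2 + 4 * \<bar>lam\<bar>) * t + 2 * t\<^sup>2) has_real_derivative 2 * lip lam t)
        (at t within {0..})"
      by (auto intro!: derivative_eq_intros simp: lip_def algebra_simps)
  qed (auto intro!: continuous_intros simp: lip_def)
  then have "\<exists>y. y 0 = pi / 2 \<and>
     (\<forall>x\<ge>0. (y has_real_derivative prufer_rhs lam x (y x)) (at x within {0..}))" by blast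
  from someI_ex[OF this] show "theta lam 0 = pi / 2" "0 \<le> x \<Longrightarrow>
    (theta lam has_real_derivative prufer_rhs lam x (theta lam x)) (at x within {0..})"
    unfolding theta_def by auto
qed

lemma theta_cont: "continuous_on {0..} (theta lam)"
  by (rule deriv_within_imp_continuous_on) (auto intro: theta_deriv)

text \<open>This is \<open>r' / r\<close>, from \<open>r * r' = u * u' + v * v'\<close>. Defining
  the amplitude as the exponential of its integral makes it positive at once, and the system for
  \<open>(u, v)\<close> becomes an algebraic check.\<close>

definition log_amp_deriv :: "real \<Rightarrow> real \<Rightarrow> real" where
  "log_amp_deriv lam x = Q x * ((sin (theta lam x))\<^sup>2 - (cos (theta lam x))\<^sup>2)
     + sin (theta lam x) * cos (theta lam x) * (1 + x - lam - (Q x)\<^sup>2)"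

definition amp :: "real \<Rightarrow> real \<Rightarrow> real" where
  "amp lam x = exp (integral {0..x} (log_amp_deriv lam))"

definition u :: "real \<Rightarrow> real \<Rightarrow> real" where "u lam x = amp lam x * sin (theta lam x)"

text \<open>The quasi-derivative \<open>u' - Q u\<close>: unlike \<open>u'\<close>, it is continuously differentiable.\<close>

definition v :: "real \<Rightarrow> real \<Rightarrow> real" where "v lam x = amp lam x * cos (theta lam x)"

lemma amp_pos: "0 < amp lam x"
  by (simp add: amp_def)

lemma u_0 [simp]: "u lam 0 = 1" and v_0 [simp]: "v lam 0 = 0"
  by (simp_all add: u_def v_def amp_def)

lemma amp_deriv:
  assumes "0 \<le> x"
  shows "(amp lam has_real_derivative amp lam x * log_amp_deriv lam x) (at x within {0..})"
proof -
  have "continuous_on {0..} (log_amp_deriv lam)"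
    unfolding log_amp_deriv_def by (intro continuous_intros Q_cont theta_cont)
  from integral_has_real_derivative_atLeast[OF this assms] show ?thesis
    unfolding amp_def by (auto intro!: derivative_eq_intros)
qed

lemma u_deriv:
  assumes "0 \<le> x"
  shows "(u lam has_real_derivative Q x * u lam x + v lam x) (at x within {0..})"
proof -
  have alg: "r * (Q*(S^2-C^2)+S*C*(1+x-l-Q^2)) * S + C * ((C+Q*S)^2+(l-x)*S^2) * r = Q*(r*S)+r*C"
    if "S\<^sup>2 + C\<^sup>2 = 1" for S C r Q l :: real
    using that by algebra
  have "(u lam has_real_derivative amp lam x * log_amp_deriv lam x * sin (theta lam x)
      + cos (theta lam x) * prufer_rhs lam x (theta lam x) * amp lam x) (at x within {0..})"
    unfolding u_def by (intro DERIV_mult DERIV_chain2[OF DERIV_sin theta_deriv] amp_deriv assms)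
  then show ?thesis
    unfolding log_amp_deriv_def prufer_rhs_def u_def v_def by (subst (asm) alg) auto
qed

lemma v_deriv:
  assumes "0 \<le> x"
  shows "(v lam has_real_derivative (x - lam - (Q x)\<^sup>2) * u lam x - Q x * v lam x) (at x within {0..})"
proof -
  have alg: "r * (Q*(S^2-C^2)+S*C*(1+x-l-Q^2)) * C + - S * ((C+Q*S)^2+(l-x)*S^2) * r
      = (x - l - Q^2) * (r * S) - Q * (r * C)"
    if "S\<^sup>2 + C\<^sup>2 = 1" for S C r Q l :: real
    using that by algebra
  have "(v lam has_real_derivative amp lam x * log_amp_deriv lam x * cos (theta lam x)
      + - sin (theta lam x) * prufer_rhs lam x (theta lam x) * amp lam x) (at x within {0..})"
    unfolding v_def by (intro DERIV_mult DERIV_chain2[OF DERIV_cos theta_deriv] amp_deriv assms)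
  then show ?thesis
    unfolding log_amp_deriv_def prufer_rhs_def u_def v_def by (subst (asm) alg) auto
qed

lemma u_cont: "continuous_on {0..} (u lam)" and v_cont: "continuous_on {0..} (v lam)"
  by (rule deriv_within_imp_continuous_on, auto intro: u_deriv v_deriv)+

section \<open>Uniqueness of solutions and the characterisation of eigenvalues\<close>

lemma sum_squares_deriv_le:
  fixes U V P w :: real
  assumes "\<bar>w\<bar> \<le> K" "\<bar>P\<bar> \<le> B"
  shows "2 * U * (w * U + V) + 2 * V * ((P - w\<^sup>2) * U - w * V) \<le> (2 * K + 1 + B + K\<^sup>2) * (U\<^sup>2 + V\<^sup>2)"
proof -
  have "\<bar>w\<bar> * (U\<^sup>2 + V\<^sup>2) \<le> K * (U\<^sup>2 + V\<^sup>2)" using assms by (intro mult_right_mono) auto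
  moreover have "\<bar>w * (U\<^sup>2 - V\<^sup>2)\<bar> \<le> \<bar>w\<bar> * (U\<^sup>2 + V\<^sup>2)"
    unfolding abs_mult by (intro mult_left_mono) (auto simp: abs_le_iff)
  moreover have w2: "w\<^sup>2 \<le> K\<^sup>2" using assms(1) K_nonneg by (simp add: abs_le_square_iff[symmetric])
  moreover have "\<bar>(1 + P - w\<^sup>2) * (2 * U * V)\<bar> \<le> (1 + B + K\<^sup>2) * (U\<^sup>2 + V\<^sup>2)"
    unfolding abs_mult[of "1 + P - w\<^sup>2"]
  proof (intro mult_mono)
    show "\<bar>1 + P - w\<^sup>2\<bar> \<le> 1 + B + K\<^sup>2" using w2 assms(2) zero_le_power2[of w] by linarith
    show "\<bar>2 * U * V\<bar> \<le> U\<^sup>2 + V\<^sup>2"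
      using zero_le_power2[of "U - V"] zero_le_power2[of "U + V"]
      by (auto simp: power2_diff power2_sum abs_le_iff)
  qed (use assms in auto)
  moreover have "2 * U * (w * U + V) + 2 * V * ((P - w\<^sup>2) * U - w * V)
      = 2 * (w * (U\<^sup>2 - V\<^sup>2)) + (1 + P - w\<^sup>2) * (2 * U * V)"
    by (simp add: power2_eq_square algebra_simps)
  ultimately show ?thesis by (simp add: algebra_simps)
qed

lemma zero_solution:
  fixes U V :: "real \<Rightarrow> real"
  assumes U: "\<And>x. 0 \<le> x \<Longrightarrow> (U has_real_derivative Q x * U x + V x) (at x within {0..})"
    and V: "\<And>x. 0 \<le> x \<Longrightarrow>
      (V has_real_derivative (x - lam - (Q x)\<^sup>2) * U x - Q x * V x) (at x within {0..})"
    and "U 0 = 0" "V 0 = 0" "0 \<le> b"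
  shows "U b = 0"
proof -
  have "(U b)\<^sup>2 + (V b)\<^sup>2 \<le> ((U 0)\<^sup>2 + (V 0)\<^sup>2) * exp ((2 * K + 1 + (b + \<bar>lam\<bar>) + K\<^sup>2) * (b - 0))"
  proof (rule gronwall_within[OF \<open>0 \<le> b\<close>, of "{0..}"])
    fix x assume x: "x \<in> {0..b}"
    show "((\<lambda>x. (U x)\<^sup>2 + (V x)\<^sup>2) has_real_derivative
        2 * U x * (Q x * U x + V x) + 2 * V x * ((x - lam - (Q x)\<^sup>2) * U x - Q x * V x))
        (at x within {0..})"
      using x by (auto intro!: derivative_eq_intros U V)
    show "2 * U x * (Q x * U x + V x) + 2 * V x * ((x - lam - (Q x)\<^sup>2) * U x - Q x * V x)
        \<le> (2 * K + 1 + (b + \<bar>lam\<bar>) + K\<^sup>2) * ((U x)\<^sup>2 + (V x)\<^sup>2)"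
      by (rule sum_squares_deriv_le) (use x Q_bound in auto)
  qed auto
  then show ?thesis using assms by (simp add: sum_power2_le_zero_iff)
qed

text \<open>Both \<open>phi\<close> and \<open>phi 0 * u lam\<close> solve the first-order system
  with the same data at \<open>0\<close>, so \<open>zero_solution\<close> applies to their
  difference. In particular \<open>phi 0 = 0\<close> would force \<open>phi\<close> to
  vanish.\<close>

lemma eigenfunction_eq_u:
  assumes "is_eigenfunction_N q lam phi"
  shows "phi 0 \<noteq> 0" "0 \<le> x \<Longrightarrow> phi x = phi 0 * u lam x"
    "(\<lambda>x. (u lam x)\<^sup>2) integrable_on {0..}"
proof -
  obtain phi1 phi2 where phi: "loc_AC_deriv phi phi1" and phi1: "loc_AC_deriv phi1 phi2"
    and L2: "(\<lambda>x. (phi x)\<^sup>2) integrable_on {0..}" and bc: "phi1 0 = 0"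
    and ae: "AE x in lebesgue. 0 \<le> x \<longrightarrow> - phi2 x + (x + q x) * phi x = lam * phi x"
    using assms unfolding is_eigenfunction_N_def by blast
  define w where "w x = phi1 x - Q x * phi x" for x
  have cont: "continuous_on {0..} phi" "continuous_on {0..} phi1"
    using phi phi1 loc_AC_deriv_continuous_on by blast+
  have U: "(phi has_real_derivative Q x * phi x + w x) (at x within {0..})" if "0 \<le> x" for x
    using loc_AC_deriv_has_real_derivative[OF phi cont(2) that] by (simp add: w_def)
  have "loc_AC_deriv w (\<lambda>x. phi2 x - (q x * phi x + Q x * phi1 x))"
    unfolding w_def by (intro loc_AC_deriv_diff_fun loc_AC_deriv_mult phi phi1 Q_AC)
  \<comment> \<open>Here \<open>q\<close> disappears:
    \<open>phi2 - q * phi = (x - lam) * phi\<close> almost everywhere. The new density is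
    continuous, so \<open>w\<close> is differentiable in the classical sense.\<close>
  then have "loc_AC_deriv w (\<lambda>x. (x - lam) * phi x - Q x * phi1 x)"
    by (rule loc_AC_deriv_cong_AE) (use ae in \<open>eventually_elim, auto simp: algebra_simps\<close>)
  then have W: "(w has_real_derivative (x - lam) * phi x - Q x * phi1 x) (at x within {0..})"
    if "0 \<le> x" for x
    by (rule loc_AC_deriv_has_real_derivative) (intro continuous_intros cont Q_cont that)+
  have zero: "phi x - phi 0 * u lam x = 0" if "0 \<le> x" for x
  proof (rule zero_solution[where U = "\<lambda>x. phi x - phi 0 * u lam x" and V = "\<lambda>x. w x - phi 0 * v lam x" and lam = lam])
    fix x :: real assume "0 \<le> x"
    then show "((\<lambda>x. phi x - phi 0 * u lam x) has_real_derivative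
        Q x * (phi x - phi 0 * u lam x) + (w x - phi 0 * v lam x)) (at x within {0..})"
      by (auto intro!: derivative_eq_intros U u_deriv simp: algebra_simps)
    show "((\<lambda>x. w x - phi 0 * v lam x) has_real_derivative
        (x - lam - (Q x)\<^sup>2) * (phi x - phi 0 * u lam x) - Q x * (w x - phi 0 * v lam x))
        (at x within {0..})"
      by (rule DERIV_cong[OF DERIV_diff[OF W DERIV_cmult[OF v_deriv]]])
        (simp_all add: \<open>0 \<le> x\<close> w_def power2_eq_square algebra_simps)
  qed (use that bc in \<open>auto simp: w_def\<close>)
  show "0 \<le> x \<Longrightarrow> phi x = phi 0 * u lam x" using zero[of x] by linarith
  show "phi 0 \<noteq> 0"
  proof
    assume "phi 0 = 0"
    then have "phi x = 0" if "0 \<le> x" for x using zero[OF that] by simp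
    with assms show False unfolding is_eigenfunction_N_def by blast
  qed
  then have eq: "(1 / (phi 0)\<^sup>2) * (phi x)\<^sup>2 = (u lam x)\<^sup>2" if "x \<in> {0..}" for x
    using zero[of x] that
    by (simp add: eq_iff_diff_eq_0[of "phi x", symmetric] power_mult_distrib)
  show "(\<lambda>x. (u lam x)\<^sup>2) integrable_on {0..}"
    by (rule integrable_eq[OF integrable_on_mult_right[OF L2] eq])
qed

definition du :: "real \<Rightarrow> real \<Rightarrow> real" where "du lam x = Q x * u lam x + v lam x"

lemma u_AC: "loc_AC_deriv (u lam) (du lam)"
  unfolding du_def
  by (rule loc_AC_deriv_of_C1) (auto intro!: u_deriv continuous_intros Q_cont u_cont v_cont)

lemma du_AC: "loc_AC_deriv (du lam) (\<lambda>x. (x + q x - lam) * u lam x)"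
proof -
  have dv: "loc_AC_deriv (v lam) (\<lambda>x. (x - lam - (Q x)\<^sup>2) * u lam x - Q x * v lam x)"
    by (rule loc_AC_deriv_of_C1) (auto intro!: v_deriv continuous_intros Q_cont u_cont v_cont)
  have "(\<lambda>x. (q x * u lam x + Q x * du lam x)
        + ((x - lam - (Q x)\<^sup>2) * u lam x - Q x * v lam x)) = (\<lambda>x. (x + q x - lam) * u lam x)"
    by (auto simp: du_def algebra_simps power2_eq_square)
  then show ?thesis
    using loc_AC_deriv_add[OF loc_AC_deriv_mult[OF Q_AC u_AC[of lam]] dv] by (simp add: du_def[abs_def])
qed

lemma u_is_eigenfunction:
  assumes "(\<lambda>x. (u lam x)\<^sup>2) integrable_on {0..}"
  shows "is_eigenfunction_N q lam (u lam)"
  unfolding is_eigenfunction_N_def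
proof (intro conjI exI)
  show "loc_AC_deriv (u lam) (du lam)" by (rule u_AC)
  show "loc_AC_deriv (du lam) (\<lambda>x. (x + q x - lam) * u lam x)" by (rule du_AC)
  show "(\<lambda>x. (u lam x)\<^sup>2) integrable_on {0..}" by fact
  have "(\<lambda>x. (- ((x + q x - lam) * u lam x) + (x + q x) * u lam x)\<^sup>2) = (\<lambda>x. lam\<^sup>2 * (u lam x)\<^sup>2)"
    by (auto simp: algebra_simps power2_eq_square)
  then show "(\<lambda>x. (- ((x + q x - lam) * u lam x) + (x + q x) * u lam x)\<^sup>2) integrable_on {0..}"
    using integrable_on_mult_right[OF assms] by simp
  show "AE x in lebesgue. 0 \<le> x \<longrightarrow>
      - ((x + q x - lam) * u lam x) + (x + q x) * u lam x = lam * u lam x"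
    by (simp add: algebra_simps)
  show "du lam 0 = 0" by (simp add: du_def)
  show "0 \<le> (0::real)" "u lam 0 \<noteq> 0" by simp_all
qed

lemma eigenvalues_eq: "eigenvalues_N q = {lam. (\<lambda>x. (u lam x)\<^sup>2) integrable_on {0..}}"
  unfolding eigenvalues_N_def using eigenfunction_eq_u(3) u_is_eigenfunction by blast

lemma eigenfunction_quotient:
  assumes "is_eigenfunction_N q lam phi"
  shows "integral {0..} (\<lambda>x. (phi x)\<^sup>2) / (phi 0)\<^sup>2 = integral {0..} (\<lambda>x. (u lam x)\<^sup>2)"
proof -
  have "integral {0..} (\<lambda>x. (phi x)\<^sup>2) = integral {0..} (\<lambda>x. (phi 0)\<^sup>2 * (u lam x)\<^sup>2)"
  proof (rule Henstock_Kurzweil_Integration.integral_cong)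
    fix x :: real assume "x \<in> {0..}"
    then have "phi x = phi 0 * u lam x" using eigenfunction_eq_u(2)[OF assms, of x] by auto
    then have "(phi x)\<^sup>2 = (phi 0 * u lam x)\<^sup>2" by (rule arg_cong)
    then show "(phi x)\<^sup>2 = (phi 0)\<^sup>2 * (u lam x)\<^sup>2" by (simp only: power_mult_distrib)
  qed
  then show ?thesis using eigenfunction_eq_u(1)[OF assms] by simp
qed

subsection \<open>Behaviour beyond the turning point and dependence on the spectral parameter\<close>

lemma uv_deriv:
  assumes "0 \<le> x"
  shows "((\<lambda>x. u lam x * v lam x) has_real_derivative
    (v lam x)\<^sup>2 + (x - lam - (Q x)\<^sup>2) * (u lam x)\<^sup>2) (at x within {0..})"
  by (rule DERIV_cong[OF DERIV_mult[OF u_deriv v_deriv]])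
    (simp_all add: assms power2_eq_square algebra_simps)

text \<open>Chosen so that the coefficient \<open>x - lam - (Q x)^2\<close> is at least
  \<open>1\<close> from here on; the maximum keeps the point on the half-line when
  \<open>lam\<close> is very negative.\<close>

definition x0 :: "real \<Rightarrow> real" where "x0 lam = max 0 (lam + K\<^sup>2 + 1)"

lemma x0_nonneg: "0 \<le> x0 lam" by (simp add: x0_def)

lemma potential_ge_1: "x0 lam \<le> x \<Longrightarrow> 1 \<le> x - lam - (Q x)\<^sup>2"
  using Q_power2_bound[of x] by (simp add: x0_def)

lemma u2_v2: "(u lam x)\<^sup>2 + (v lam x)\<^sup>2 = (amp lam x)\<^sup>2"
  by (simp add: u_def v_def power_mult_distrib flip: distrib_left)

lemma uv_deriv_ge:
  assumes "x0 lam \<le> x"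
  shows "(u lam x)\<^sup>2 + (v lam x)\<^sup>2 \<le> (v lam x)\<^sup>2 + (x - lam - (Q x)\<^sup>2) * (u lam x)\<^sup>2"
  using mult_right_mono[OF potential_ge_1[OF assms], of "(u lam x)\<^sup>2"] by simp

lemma uv_strict_mono:
  assumes "x0 lam \<le> a" "a < b"
  shows "u lam a * v lam a < u lam b * v lam b"
proof (rule deriv_within_pos_strict_mono[OF assms(2), of "{0..}", OF _ uv_deriv])
  fix x assume "x \<in> {a..b}"
  then show "0 < (v lam x)\<^sup>2 + (x - lam - (Q x)\<^sup>2) * (u lam x)\<^sup>2"
    using uv_deriv_ge[of lam x] u2_v2[of lam x] amp_pos[of lam x] assms
    by (smt (verit) atLeastAtMost_iff zero_less_power)
qed (use assms x0_nonneg[of lam] in auto)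

lemma integral_uv_deriv:
  assumes "0 \<le> a" "a \<le> b"
  shows "integral {a..b} (\<lambda>x. (v lam x)\<^sup>2 + (x - lam - (Q x)\<^sup>2) * (u lam x)\<^sup>2)
    = u lam b * v lam b - u lam a * v lam a"
proof -
  have "loc_AC_deriv (\<lambda>x. u lam x * v lam x) (\<lambda>x. (v lam x)\<^sup>2 + (x - lam - (Q x)\<^sup>2) * (u lam x)\<^sup>2)"
    by (rule loc_AC_deriv_of_C1[OF uv_deriv]) (auto intro!: continuous_intros Q_cont u_cont v_cont)
  from loc_AC_deriv_diff[OF this assms] show ?thesis by simp
qed

lemma integral_u2_v2_le:
  assumes "x0 lam \<le> a" "a \<le> b"
  shows "integral {a..b} (\<lambda>x. (u lam x)\<^sup>2 + (v lam x)\<^sup>2) \<le> u lam b * v lam b - u lam a * v lam a"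
proof -
  have "0 \<le> a" using assms x0_nonneg[of lam] by simp
  then have "integral {a..b} (\<lambda>x. (u lam x)\<^sup>2 + (v lam x)\<^sup>2)
      \<le> integral {a..b} (\<lambda>x. (v lam x)\<^sup>2 + (x - lam - (Q x)\<^sup>2) * (u lam x)\<^sup>2)"
    by (intro integral_le continuous_integrable_Icc)
      (use uv_deriv_ge[of lam] assms in \<open>auto intro!: continuous_intros Q_cont u_cont v_cont\<close>)
  also have "\<dots> = u lam b * v lam b - u lam a * v lam a"
    by (rule integral_uv_deriv[OF \<open>0 \<le> a\<close> assms(2)])
  finally show ?thesis .
qed

text \<open>Beyond \<open>x0 lam\<close> the increment of \<open>u * v\<close> dominates the
  integral of \<open>u^2\<close>, and an increment that ends at a nonpositive value is at most
  \<open>- u * v\<close> taken at \<open>x0 lam\<close>.\<close>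

lemma eigenvalueI:
  assumes neg: "\<And>x. x0 lam < x \<Longrightarrow> u lam x * v lam x \<le> 0"
  shows "lam \<in> eigenvalues_N q"
proof -
  have int: "(\<lambda>x. (u lam x)\<^sup>2) integrable_on {a..b}" if "0 \<le> a" for a b
    by (rule continuous_integrable_Icc[OF _ that]) (intro continuous_intros u_cont)
  obtain I where "((\<lambda>x. (u lam x)\<^sup>2) has_integral I) {0..}"
  proof (rule nonneg_continuous_has_integral_atLeast[of "\<lambda>x. (u lam x)\<^sup>2"
        "integral {0..x0 lam} (\<lambda>x. (u lam x)\<^sup>2) - u lam (x0 lam) * v lam (x0 lam)"])
    show "continuous_on {0..} (\<lambda>x. (u lam x)\<^sup>2)" by (intro continuous_intros u_cont)
    fix x :: real assume "0 \<le> x"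
    \<comment> \<open>The sign hypothesis holds strictly beyond \<open>x0 lam\<close>, hence the
      \<open>+ 1\<close>.\<close>
    define y where "y = max x (x0 lam + 1)"
    have "integral {0..x} (\<lambda>x. (u lam x)\<^sup>2) \<le> integral {0..y} (\<lambda>x. (u lam x)\<^sup>2)"
      by (rule integral_subset_le) (auto intro!: int simp: y_def)
    also have "\<dots> = integral {0..x0 lam} (\<lambda>x. (u lam x)\<^sup>2) + integral {x0 lam..y} (\<lambda>x. (u lam x)\<^sup>2)"
      by (rule Henstock_Kurzweil_Integration.integral_combine[symmetric])
        (auto intro!: int simp: y_def x0_nonneg)
    also have "integral {x0 lam..y} (\<lambda>x. (u lam x)\<^sup>2)
        \<le> integral {x0 lam..y} (\<lambda>x. (u lam x)\<^sup>2 + (v lam x)\<^sup>2)"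
      by (intro integral_le continuous_integrable_Icc)
        (auto intro!: continuous_intros u_cont v_cont simp: x0_nonneg)
    also have "\<dots> \<le> u lam y * v lam y - u lam (x0 lam) * v lam (x0 lam)"
      by (rule integral_u2_v2_le) (auto simp: y_def)
    also have "u lam y * v lam y \<le> 0" by (rule neg) (auto simp: y_def)
    finally show "integral {0..x} (\<lambda>x. (u lam x)\<^sup>2)
        \<le> integral {0..x0 lam} (\<lambda>x. (u lam x)\<^sup>2) - u lam (x0 lam) * v lam (x0 lam)" by simp
  qed auto
  then show ?thesis by (auto simp: eigenvalues_eq integrable_on_def)
qed

text \<open>If \<open>u v\<close> is positive somewhere beyond the turning point, it stays bounded away from \<open>0\<close>
  and \<open>u\<^sup>2\<close> grows linearly.\<close>

lemma eigenvalue_uv_nonpos: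
  assumes "lam \<in> eigenvalues_N q" "x0 lam \<le> a"
  shows "u lam a * v lam a \<le> 0"
proof (rule ccontr)
  assume "\<not> u lam a * v lam a \<le> 0"
  define c where "c = u lam a * v lam a"
  have "0 < c" using \<open>\<not> u lam a * v lam a \<le> 0\<close> by (simp add: c_def)
  have "0 \<le> a" using assms x0_nonneg[of lam] by simp
  define I where "I = integral {0..} (\<lambda>x. (u lam x)\<^sup>2)"
  have L2: "(\<lambda>x. (u lam x)\<^sup>2) integrable_on {0..}" using assms by (simp add: eigenvalues_eq)
  have le_I: "integral {0..x} (\<lambda>x. (u lam x)\<^sup>2) \<le> I" for x
    unfolding I_def by (rule integral_le_integral_atLeast[OF L2]) auto
  have cont: "continuous_on {0..} (\<lambda>x. (u lam x)\<^sup>2)" by (intro continuous_intros u_cont)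
  \<comment> \<open>From \<open>(u^2)' = 2 * Q * u^2 + 2 * u * v \<ge> 2 * c - 2 * K * u^2\<close>.
    The last term is integrated and bounded by \<open>2 * K * I\<close>, so the lower bound stays
    linear in \<open>x\<close>.\<close>
  have growth: "2 * c * (x - a) - 2 * K * I \<le> (u lam x)\<^sup>2" if "a \<le> x" for x
  proof -
    let ?J = "\<lambda>x. integral {0..x} (\<lambda>x. (u lam x)\<^sup>2)"
    have "(2 * c * x - 2 * K * ?J x) - (2 * c * a - 2 * K * ?J a) \<le> (u lam x)\<^sup>2 - (u lam a)\<^sup>2"
    proof (rule deriv_within_diff_le[OF that, of "{0..}"])
      fix y assume y: "y \<in> {a..x}"
      then have "0 \<le> y" using \<open>0 \<le> a\<close> by simp
      show "((\<lambda>x. 2 * c * x - 2 * K * ?J x) has_real_derivative 2 * c - 2 * K * (u lam y)\<^sup>2)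
          (at y within {0..})"
        by (rule DERIV_diff DERIV_cmult integral_has_real_derivative_atLeast cont \<open>0 \<le> y\<close> DERIV_cmult_Id)+
      show "((\<lambda>x. (u lam x)\<^sup>2) has_real_derivative 2 * u lam y * (Q y * u lam y + v lam y))
          (at y within {0..})"
        by (auto intro!: derivative_eq_intros u_deriv \<open>0 \<le> y\<close>)
      have "c \<le> u lam y * v lam y"
        using uv_strict_mono[OF assms(2), of y] y by (cases "y = a") (auto simp: c_def)
      moreover have "- K * (u lam y)\<^sup>2 \<le> Q y * (u lam y)\<^sup>2"
        using Q_bound[OF \<open>0 \<le> y\<close>] by (intro mult_right_mono) auto
      ultimately show "2 * c - 2 * K * (u lam y)\<^sup>2 \<le> 2 * u lam y * (Q y * u lam y + v lam y)"
        by (simp add: power2_eq_square algebra_simps)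
    qed (use \<open>0 \<le> a\<close> in auto)
    moreover have "2 * K * ?J x \<le> 2 * K * I" using K_nonneg by (intro mult_left_mono le_I) auto
    moreover have "0 \<le> 2 * K * ?J a"
      using K_nonneg by (intro mult_nonneg_nonneg integral_nonneg continuous_integrable_Icc cont) auto
    moreover have "2 * c * (x - a) = 2 * c * x - 2 * c * a" by (simp add: algebra_simps)
    ultimately show ?thesis using zero_le_power2[of "u lam a"] by linarith
  qed
  have "0 \<le> I" using le_I[of 0] by simp
  \<comment> \<open>The point where the linear lower bound reaches \<open>1\<close>.\<close>
  define y where "y = a + (1 + 2 * K * I) / (2 * c)"
  have "a \<le> y" unfolding y_def using \<open>0 < c\<close> \<open>0 \<le> I\<close> K_nonneg by simp
  have "\<exists>x\<ge>0. y \<le> x \<and> (u lam x)\<^sup>2 < 1"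
    by (rule small_value_of_bounded_integral[OF cont le_I]) auto
  then obtain x where x: "y \<le> x" "(u lam x)\<^sup>2 < 1" by blast
  have "1 + 2 * K * I = 2 * c * (y - a)" using \<open>0 < c\<close> by (simp add: y_def)
  also have "\<dots> \<le> 2 * c * (x - a)" using x \<open>0 < c\<close> by (intro mult_left_mono) auto
  finally show False using growth[of x] x \<open>a \<le> y\<close> by simp
qed

lemma eigenvalue_uv_neg:
  assumes "lam \<in> eigenvalues_N q" "x0 lam \<le> x"
  shows "u lam x * v lam x < 0"
  using uv_strict_mono[OF assms(2), of "x+1"] eigenvalue_uv_nonpos[OF assms(1), of "x+1"] assms(2)
  by simp

section \<open>Barriers for the angle\<close>

lemma prufer_rhs_ge:
  assumes "0 \<le> x" "x \<le> b"
  shows "prufer_rhs lam x z - lip lam b * \<bar>y - z\<bar> \<le> prufer_rhs lam x y"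
    "prufer_rhs lam x y \<le> prufer_rhs lam x z + lip lam b * \<bar>y - z\<bar>"
proof -
  have "lip lam x * \<bar>y - z\<bar> \<le> lip lam b * \<bar>y - z\<bar>"
    using assms by (intro mult_right_mono) (auto simp: lip_def)
  then show "prufer_rhs lam x z - lip lam b * \<bar>y - z\<bar> \<le> prufer_rhs lam x y"
    "prufer_rhs lam x y \<le> prufer_rhs lam x z + lip lam b * \<bar>y - z\<bar>"
    using prufer_rhs_lipschitz[OF assms(1), of lam y z] by linarith+
qed

text \<open>At a multiple of \<open>pi\<close> the slope of the angle is \<open>1\<close>, so such a
  level is crossed only upwards. The Lipschitz bound turns the slope at the level into a
  differential inequality for the distance to it.\<close>

lemma theta_ge_pi_multiple:
  fixes m :: nat
  assumes "0 \<le> a" "a \<le> b" "real m * pi \<le> theta lam a"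
  shows "real m * pi \<le> theta lam b"
proof -
  have "0 \<le> theta lam b - real m * pi"
  proof (rule differential_inequality_nonneg[OF assms(2), of "{0..}"])
    fix x assume x: "x \<in> {a..b}"
    then show "((\<lambda>x. theta lam x - real m * pi) has_real_derivative prufer_rhs lam x (theta lam x) - 0)
        (at x within {0..})"
      using assms by (intro DERIV_diff theta_deriv DERIV_const) auto
    have "prufer_rhs lam x (real m * pi) = 1"
      by (simp add: prufer_rhs_def flip: power_mult)
    then show "- lip lam b * \<bar>theta lam x - real m * pi\<bar> \<le> prufer_rhs lam x (theta lam x) - 0"
      using prufer_rhs_ge(1)[of x b lam "real m * pi" "theta lam x"] x assms by simp
  qed (use assms in auto)
  then show ?thesis by simp
qed

lemma theta_nonneg: "0 \<le> x \<Longrightarrow> 0 \<le> theta lam x"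
  using theta_ge_pi_multiple[of 0 x 0 lam] by simp

text \<open>At the level \<open>(m + 1/2) * pi\<close> the slope is \<open>Q^2 + lam - x\<close>,
  which is at most \<open>-1\<close> beyond \<open>x0 lam\<close>: there it is crossed only
  downwards.\<close>

lemma theta_le_half_pi_multiple:
  fixes m :: nat
  assumes "x0 lam \<le> a" "a \<le> b" "theta lam a \<le> (real m + 1/2) * pi"
  shows "theta lam b \<le> (real m + 1/2) * pi"
proof -
  let ?c = "(real m + 1/2) * pi"
  have "0 \<le> a" using assms x0_nonneg[of lam] by simp
  have "0 \<le> ?c - theta lam b"
  proof (rule differential_inequality_nonneg[OF assms(2), of "{0..}"])
    fix x assume x: "x \<in> {a..b}"
    then show "((\<lambda>x. ?c - theta lam x) has_real_derivative 0 - prufer_rhs lam x (theta lam x))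
        (at x within {0..})"
      using \<open>0 \<le> a\<close> by (intro DERIV_diff theta_deriv DERIV_const) auto
    have c: "?c = pi / 2 + real m * pi" by (simp add: algebra_simps)
    have "prufer_rhs lam x ?c = (Q x)\<^sup>2 + (lam - x)"
      unfolding c by (simp add: prufer_rhs_def sin_add cos_add power_mult_distrib flip: power_mult)
    then have "prufer_rhs lam x ?c \<le> 0" using potential_ge_1[of lam x] x assms by simp
    then show "- lip lam b * \<bar>?c - theta lam x\<bar> \<le> 0 - prufer_rhs lam x (theta lam x)"
      using prufer_rhs_ge(2)[of x b lam "theta lam x" ?c] x \<open>0 \<le> a\<close>
      by (simp add: abs_minus_commute)
  qed (use assms \<open>0 \<le> a\<close> in auto)
  then show ?thesis by simp
qed

section \<open>Dependence of the angle on the spectral parameter\<close>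

lemma prufer_rhs_diff_lam: "prufer_rhs lam' x y = prufer_rhs lam x y + (lam' - lam) * (sin y)\<^sup>2"
  by (simp add: prufer_rhs_def algebra_simps)

lemma theta_diff_deriv:
  "0 \<le> x \<Longrightarrow> ((\<lambda>x. theta lam' x - theta lam x) has_real_derivative
     prufer_rhs lam' x (theta lam' x) - prufer_rhs lam x (theta lam x)) (at x within {0..})"
  by (intro DERIV_diff theta_deriv)

lemma theta_diff_deriv_ge:
  assumes "lam \<le> lam'" "0 \<le> x" "x \<le> b"
  shows "- lip lam' b * \<bar>theta lam' x - theta lam x\<bar>
    \<le> prufer_rhs lam' x (theta lam' x) - prufer_rhs lam x (theta lam x)"
  using prufer_rhs_ge(1)[OF assms(2,3), of lam' "theta lam x" "theta lam' x"] assms(1)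
  by (simp add: prufer_rhs_diff_lam[of lam' x "theta lam x" lam])
    (smt (verit) mult_nonneg_nonneg zero_le_power2)

lemma theta_mono:
  assumes "lam \<le> lam'" "0 \<le> x"
  shows "theta lam x \<le> theta lam' x"
proof -
  have "0 \<le> theta lam' x - theta lam x"
    by (rule differential_inequality_nonneg[OF assms(2), of "{0..}", OF _ theta_diff_deriv
        theta_diff_deriv_ge[OF assms(1)]]) auto
  then show ?thesis by simp
qed

text \<open>Both angles start at \<open>pi / 2\<close> with slopes that differ by
  \<open>lam' - lam\<close>, so they separate at once; Gronwall for the negated difference keeps
  them apart.\<close>

lemma theta_strict_mono:
  assumes "lam < lam'" "0 < b"
  shows "theta lam b < theta lam' b"
proof -
  let ?d = "\<lambda>x. theta lam' x - theta lam x"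
  have "(?d has_real_derivative lam' - lam) (at 0 within {0..})"
    using theta_diff_deriv[of 0 lam' lam] by (simp add: prufer_rhs_def)
  from has_real_derivative_pos_inc_right[OF this] assms(1)
  obtain e where "e > 0" and e: "\<And>h. 0 < h \<Longrightarrow> h < e \<Longrightarrow> ?d 0 < ?d (0 + h)"
    by (metis add_0 atLeast_iff diff_gt_0_iff_gt less_imp_le)
  define h where "h = min b (e/2)"
  have h: "0 < h" "h < e" "h \<le> b" using \<open>e > 0\<close> assms(2) by (auto simp: h_def)
  have "- ?d b \<le> - ?d h * exp ((- lip lam' b) * (b - h))"
  proof (rule gronwall_within[OF h(3), of "{0..}"])
    fix x assume x: "x \<in> {h..b}"
    show "((\<lambda>x. - ?d x) has_real_derivative
        - (prufer_rhs lam' x (theta lam' x) - prufer_rhs lam x (theta lam x))) (at x within {0..})"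
      using x h by (intro DERIV_minus theta_diff_deriv) auto
    have "0 \<le> ?d x" using theta_mono[of lam lam' x] assms x h by simp
    then show "- (prufer_rhs lam' x (theta lam' x) - prufer_rhs lam x (theta lam x))
        \<le> - lip lam' b * - ?d x"
      using theta_diff_deriv_ge[of lam lam' x b] x h assms by (simp add: algebra_simps)
  qed (use h in auto)
  moreover have "0 < ?d h * exp ((- lip lam' b) * (b - h))" using e[OF h(1,2)] by simp
  ultimately show ?thesis by linarith
qed

lemma theta_diff_le:
  assumes "lam \<le> lam'" "0 \<le> b" "\<bar>lam'\<bar> \<le> B"
  shows "theta lam' b - theta lam b \<le> (lam' - lam) * exp (lip B b * b)"
proof -
  let ?d = "\<lambda>x. theta lam' x - theta lam x"
  have lip: "lip lam' b \<le> lip B b" "1 \<le> lip B b"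
    using assms K_nonneg by (auto simp: lip_def power2_eq_square algebra_simps)
  \<comment> \<open>Adding \<open>lam' - lam\<close> makes the inequality homogeneous: with
    \<open>L = lip B b \<ge> 1\<close>, the derivative is at most
    \<open>L * d + (lam' - lam) \<le> L * (d + (lam' - lam))\<close>.\<close>
  have "?d b + (lam' - lam) \<le> (?d 0 + (lam' - lam)) * exp (lip B b * (b - 0))"
  proof (rule gronwall_within[OF assms(2), of "{0..}"])
    fix x assume x: "x \<in> {0..b}"
    show "((\<lambda>x. ?d x + (lam' - lam)) has_real_derivative
        (prufer_rhs lam' x (theta lam' x) - prufer_rhs lam x (theta lam x)) + 0) (at x within {0..})"
      using x by (intro DERIV_add theta_diff_deriv DERIV_const) auto
    have d: "0 \<le> ?d x" using theta_mono[of lam lam' x] assms x by simp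
    have "prufer_rhs lam' x (theta lam' x) \<le> prufer_rhs lam' x (theta lam x) + lip lam' b * ?d x"
      using prufer_rhs_ge(2)[of x b lam' "theta lam' x" "theta lam x"] x d by simp
    moreover have "(lam' - lam) * (sin (theta lam x))\<^sup>2 \<le> (lam' - lam) * 1"
      using assms by (intro mult_left_mono) (auto simp: abs_square_le_1)
    moreover have "lip lam' b * ?d x \<le> lip B b * ?d x" using lip d by (intro mult_right_mono) auto
    moreover have "1 * (lam' - lam) \<le> lip B b * (lam' - lam)" using lip assms by (intro mult_right_mono) auto
    ultimately show "(prufer_rhs lam' x (theta lam' x) - prufer_rhs lam x (theta lam x)) + 0
        \<le> lip B b * (?d x + (lam' - lam))"
      by (simp add: prufer_rhs_diff_lam[of lam' x "theta lam x" lam] distrib_left)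
  qed auto
  then show ?thesis using assms(1) by simp
qed

lemma theta_isCont:
  assumes "0 \<le> x"
  shows "isCont (\<lambda>lam. theta lam x) lam"
proof -
  define C where "C = exp (lip (\<bar>lam\<bar> + 1) x * x)"
  have "((\<lambda>l. theta l x - theta lam x) \<longlongrightarrow> 0) (at lam)"
  proof (rule Lim_null_comparison)
    show "\<forall>\<^sub>F l in at lam. norm (theta l x - theta lam x) \<le> \<bar>l - lam\<bar> * C"
      unfolding eventually_at
    proof (intro exI[of _ 1] conjI ballI impI)
      fix l assume "l \<noteq> lam \<and> dist l lam < 1"
      then have l: "\<bar>l - lam\<bar> < 1" by (simp add: dist_real_def)
      consider "l \<le> lam" | "lam \<le> l" by linarith
      then show "norm (theta l x - theta lam x) \<le> \<bar>l - lam\<bar> * C"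
      proof cases
        case 1
        then show ?thesis
          using theta_diff_le[OF 1 assms, of "\<bar>lam\<bar> + 1"] theta_mono[OF 1 assms] by (simp add: C_def)
      next
        case 2
        have "\<bar>l\<bar> \<le> \<bar>lam\<bar> + 1" using l by linarith
        then show ?thesis
          using theta_diff_le[OF 2 assms, of "\<bar>lam\<bar> + 1"] theta_mono[OF 2 assms] 2 by (simp add: C_def)
      qed
    qed simp
    show "((\<lambda>l. \<bar>l - lam\<bar> * C) \<longlongrightarrow> 0) (at lam)"
      by (auto intro!: tendsto_eq_intros)
  qed
  then show ?thesis by (simp add: isCont_def LIM_zero_iff)
qed

subsection \<open>Enumeration of the eigenvalues\<close>

definition phase_error :: real where
  "phase_error = (K + K\<^sup>2 + 1) + 3 + ((1 + K)\<^sup>2 + (K\<^sup>2 + 1)) * (K\<^sup>2 + 2)"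

text \<open>Over the denominator \<open>D = C^2 + s^2 * S^2\<close> the deviation has numerator
  \<open>2 * w * s * S * C + w^2 * s * S^2 + s' * S * C\<close>. Each term is controlled by
  \<open>D\<close>, using \<open>2 * \<bar>s * S * C\<bar> \<le> D\<close> and, as
  \<open>1 \<le> s\<close>, \<open>s * S^2 \<le> s^2 * S^2\<close>.\<close>

lemma phase_correction_bound:
  fixes S C w s s' :: real
  assumes SC: "S\<^sup>2 + C\<^sup>2 = 1" and "1 \<le> s" "\<bar>w\<bar> \<le> K" "\<bar>s'\<bar> \<le> 1"
  shows "\<bar>(s * ((C + w * S)\<^sup>2 + s\<^sup>2 * S\<^sup>2) + S * C * s') / (C\<^sup>2 + s\<^sup>2 * S\<^sup>2) - s\<bar> \<le> K + K\<^sup>2 + 1"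
proof -
  define D where "D = C\<^sup>2 + s\<^sup>2 * S\<^sup>2"
  have "S\<^sup>2 \<le> s\<^sup>2 * S\<^sup>2"
    using mult_right_mono[of 1 "s\<^sup>2" "S\<^sup>2"] \<open>1 \<le> s\<close> by simp
  then have "0 < D" using SC by (simp add: D_def)
  have "0 \<le> (C - s * S)\<^sup>2" "0 \<le> (C + s * S)\<^sup>2" by simp_all
  then have sSC: "2 * \<bar>s * (S * C)\<bar> \<le> D"
    unfolding D_def by (auto simp: power2_diff power2_sum power_mult_distrib abs_if algebra_simps)
  have "\<bar>S * C\<bar> \<le> s * \<bar>S * C\<bar>" using mult_right_mono[of 1 s "\<bar>S * C\<bar>"] \<open>1 \<le> s\<close> by simp
  also have "\<dots> = \<bar>s * (S * C)\<bar>" using \<open>1 \<le> s\<close> by (simp add: abs_mult)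
  finally have SC_le: "\<bar>S * C\<bar> \<le> D" using sSC by linarith
  have t1: "\<bar>w * (2 * (s * (S * C)))\<bar> \<le> K * D"
    unfolding abs_mult[of w] using sSC assms(3) by (intro mult_mono) auto
  have "w\<^sup>2 \<le> K\<^sup>2" using assms(3) K_nonneg by (simp add: abs_le_square_iff[symmetric])
  moreover have "s * S\<^sup>2 \<le> D"
  proof -
    have "s * S\<^sup>2 \<le> s\<^sup>2 * S\<^sup>2"
      using \<open>1 \<le> s\<close> by (intro mult_right_mono) (auto simp: power2_eq_square)
    then show ?thesis by (simp add: D_def add_increasing)
  qed
  ultimately have t2: "\<bar>w\<^sup>2 * (s * S\<^sup>2)\<bar> \<le> K\<^sup>2 * D"
    unfolding abs_mult[of "w\<^sup>2"] using \<open>1 \<le> s\<close> by (intro mult_mono) auto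
  have t3: "\<bar>s' * (S * C)\<bar> \<le> 1 * D"
    unfolding abs_mult[of s'] using assms(4) SC_le by (intro mult_mono) auto
  have "(s * ((C + w * S)\<^sup>2 + s\<^sup>2 * S\<^sup>2) + S * C * s') / D - s
      = (w * (2 * (s * (S * C))) + w\<^sup>2 * (s * S\<^sup>2) + s' * (S * C)) / D"
    using \<open>0 < D\<close> by (simp add: field_simps D_def power2_eq_square)
  also have "\<bar>\<dots>\<bar> \<le> (K + K\<^sup>2 + 1) * D / D"
    unfolding abs_divide using \<open>0 < D\<close> t1 t2 t3
    by (intro frac_le) (auto simp: algebra_simps)
  finally show ?thesis using \<open>0 < D\<close> by (simp add: D_def)
qed

text \<open>The angle of \<open>(\<surd>(lam - x) u, v)\<close> rotates with speed \<open>\<surd>(lam - x) + O(1)\<close> up to \<open>x = lam - 1\<close>;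
  it agrees with \<open>theta\<close> where \<open>lam - x = 1\<close> and where \<open>theta\<close> is a multiple of \<open>\<pi>/2\<close>.\<close>

lemma theta_at_turning_point:
  assumes "1 \<le> lam"
  shows "\<bar>theta lam (lam + (K\<^sup>2 + 1)) - 2/3 * sqrt lam ^ 3\<bar> \<le> phase_error * lam"
proof -
  define s where "s x = sqrt (lam - x)" for x
  define th where "th = theta lam"
  define al where "al x = th x + arctan ((s x - 1) * (sin (th x) * cos (th x)) /
    ((cos (th x))\<^sup>2 + s x * (sin (th x))\<^sup>2))" for x
  \<comment> \<open>The added term has derivative \<open>- s\<close>, which cancels the leading
    rotation speed.\<close>
  define be where "be x = al x + 2/3 * s x ^ 3" for x
  have f1: "\<bar>be (lam - 1) - be 0\<bar> \<le> (K + K\<^sup>2 + 1) * (lam - 1 - 0)"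
  proof (rule deriv_within_abs_diff_le[of _ _ "{0..}"])
    fix x assume x: "x \<in> {0..lam - 1}"
    have s1: "1 \<le> s x" using x by (simp add: s_def)
    have s2: "(s x)\<^sup>2 = lam - x" using x by (simp add: s_def)
    have ds: "(s has_real_derivative - 1 / (2 * s x)) (at x within {0..})"
      unfolding s_def using x by (auto intro!: derivative_eq_intros simp: field_simps)
    have dal: "(al has_real_derivative
        (s x * prufer_rhs lam x (th x) + sin (th x) * cos (th x) * (- 1 / (2 * s x)))
          / ((cos (th x))\<^sup>2 + (s x)\<^sup>2 * (sin (th x))\<^sup>2)) (at x within {0..})"
      unfolding al_def
      by (rule arctan_angle_deriv[OF _ ds]) (use x s1 in \<open>auto simp: th_def intro: theta_deriv\<close>)
    have "((\<lambda>x. 2/3 * s x ^ 3) has_real_derivative - s x) (at x within {0..})"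
      using s1 by (auto intro!: derivative_eq_intros ds simp: field_simps power2_eq_square)
    from DERIV_add[OF dal this]
    show "(be has_real_derivative
        (s x * ((cos (th x) + Q x * sin (th x))\<^sup>2 + (s x)\<^sup>2 * (sin (th x))\<^sup>2)
          + sin (th x) * cos (th x) * (- 1 / (2 * s x)))
          / ((cos (th x))\<^sup>2 + (s x)\<^sup>2 * (sin (th x))\<^sup>2) - s x) (at x within {0..})"
      unfolding be_def prufer_rhs_def s2 by simp
    show "\<bar>(s x * ((cos (th x) + Q x * sin (th x))\<^sup>2 + (s x)\<^sup>2 * (sin (th x))\<^sup>2)
          + sin (th x) * cos (th x) * (- 1 / (2 * s x)))
          / ((cos (th x))\<^sup>2 + (s x)\<^sup>2 * (sin (th x))\<^sup>2) - s x\<bar> \<le> K + K\<^sup>2 + 1"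
      by (rule phase_correction_bound) (use s1 x Q_bound in \<open>auto simp: field_simps\<close>)
  qed (use assms in auto)
  have f2: "be 0 = pi / 2 + 2/3 * sqrt lam ^ 3"
    by (simp add: be_def al_def th_def s_def)
  have f3: "be (lam - 1) = theta lam (lam - 1) + 2/3"
    by (simp add: be_def al_def th_def s_def)
  have f4: "\<bar>theta lam (lam + (K\<^sup>2 + 1)) - theta lam (lam - 1)\<bar>
      \<le> ((1 + K)\<^sup>2 + (K\<^sup>2 + 1)) * (lam + (K\<^sup>2 + 1) - (lam - 1))"
  proof (rule deriv_within_abs_diff_le[of _ _ "{0..}", OF _ _ theta_deriv])
    fix x assume x: "x \<in> {lam - 1..lam + (K\<^sup>2 + 1)}"
    then have "\<bar>lam - x\<bar> \<le> K\<^sup>2 + 1" by (auto simp: abs_le_iff add_increasing)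
    moreover have "0 \<le> x" using x assms by simp
    ultimately show "\<bar>prufer_rhs lam x (theta lam x)\<bar> \<le> (1 + K)\<^sup>2 + (K\<^sup>2 + 1)"
      using prufer_rhs_bound[of x lam "theta lam x"] by linarith
  qed (use assms in \<open>auto simp: add_increasing\<close>)
  have f5: "pi / 2 + 2/3 \<le> 3" using pi_less_4 by simp
  have "((1 + K)\<^sup>2 + (K\<^sup>2 + 1)) * (K\<^sup>2 + 2) * 1 \<le> ((1 + K)\<^sup>2 + (K\<^sup>2 + 1)) * (K\<^sup>2 + 2) * lam"
    by (intro mult_left_mono assms mult_nonneg_nonneg add_nonneg_nonneg) auto
  then have f6: "((1 + K)\<^sup>2 + (K\<^sup>2 + 1)) * (lam + (K\<^sup>2 + 1) - (lam - 1))
      \<le> ((1 + K)\<^sup>2 + (K\<^sup>2 + 1)) * (K\<^sup>2 + 2) * lam"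
    by (simp add: algebra_simps)
  have f7: "(K + K\<^sup>2 + 1) * (lam - 1 - 0) \<le> (K + K\<^sup>2 + 1) * lam"
    using K_nonneg by (intro mult_left_mono) auto
  \<comment> \<open>The summands of \<open>phase_error\<close> stem from the drift up to
    \<open>lam - 1\<close>, the end values \<open>pi / 2 + 2/3\<close>, and the rotation across a
    window of width \<open>K^2 + 2\<close>. As \<open>1 \<le> lam\<close>, all can be measured in
    units of \<open>lam\<close>.\<close>
  have f8: "phase_error * lam = (K + K\<^sup>2 + 1) * lam + 3 * lam
      + ((1 + K)\<^sup>2 + (K\<^sup>2 + 1)) * (K\<^sup>2 + 2) * lam"
    by (simp add: phase_error_def algebra_simps)
  have combine: "\<bar>t2 - s3\<bar> \<le> e" if "\<bar>b1 - b0\<bar> \<le> p1" "b0 = p + s3" "b1 = t1 + 2/3" "\<bar>t2 - t1\<bar> \<le> p2"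
      "p + 2/3 \<le> 3" "p2 \<le> p3" "p1 \<le> p4" "e = p4 + 3 * lam + p3" "0 < p"
    for b0 b1 p p1 p2 p3 p4 s3 t1 t2 e :: real
    using that assms by linarith
  show ?thesis by (rule combine[OF f1 f2 f3 f4 f5 f6 f7 f8]) simp
qed

text \<open>The index counts the zeros of \<open>u lam\<close>: the angle starts at
  \<open>pi / 2\<close>, passes \<open>pi, ..., m * pi\<close> once each, upwards, and is finally
  trapped in a quadrant where \<open>u * v < 0\<close>.\<close>

definition has_index :: "real \<Rightarrow> nat \<Rightarrow> bool" where
  "has_index lam m \<longleftrightarrow> lam \<in> eigenvalues_N q \<and>
     (\<forall>x\<ge>x0 lam. (real m + 1/2) * pi < theta lam x \<and> theta lam x < (real m + 1) * pi)"

lemma uv_eq: "u lam x * v lam x = (amp lam x)\<^sup>2 * (sin (theta lam x) * cos (theta lam x))"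
  by (simp add: u_def v_def power2_eq_square)

text \<open>Beyond \<open>x0 lam\<close>, \<open>u * v < 0\<close> keeps the angle off every
  multiple of \<open>pi / 2\<close>; by continuity it stays in the quadrant that contains its value
  at \<open>x0 lam\<close>.\<close>

lemma eigenvalue_has_index:
  assumes "lam \<in> eigenvalues_N q"
  obtains m where "has_index lam m"
proof
  let ?th = "theta lam"
  have neg: "sin (?th x) * cos (?th x) < 0" if "x0 lam \<le> x" for x
    using eigenvalue_uv_neg[OF assms that] amp_pos[of lam x] unfolding uv_eq
    by (simp add: mult_less_0_iff not_less[symmetric])
  define m where "m = nat \<lfloor>?th (x0 lam) / pi\<rfloor>"
  have "0 \<le> ?th (x0 lam) / pi" using theta_nonneg[OF x0_nonneg, of lam lam] by simp
  then have "real m \<le> ?th (x0 lam) / pi" "?th (x0 lam) / pi < real m + 1"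
    unfolding m_def by linarith+
  then have m: "real m * pi \<le> ?th (x0 lam)" "?th (x0 lam) < (real m + 1) * pi"
    by (simp_all add: field_simps)
  have start: "(real m + 1/2) * pi < ?th (x0 lam)"
    using sin_cos_nonneg_first_quadrant[OF m(1)] neg[of "x0 lam"] by force
  have cont: "continuous_on {x0 lam..x} ?th" for x
    by (rule continuous_on_subset[OF theta_cont]) (use x0_nonneg in auto)
  have "(real m + 1/2) * pi < ?th x \<and> ?th x < (real m + 1) * pi" if x: "x0 lam \<le> x" for x
  proof (rule ccontr)
    assume "\<not> ?thesis"
    then consider "?th x \<le> (real m + 1/2) * pi" | "(real m + 1) * pi \<le> ?th x" by linarith
    then show False
    proof cases
      case 1
      then obtain y where "x0 lam \<le> y" "?th y = (real m + 1/2) * pi"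
        using IVT2'[of ?th x "(real m + 1/2) * pi" "x0 lam"] start x cont by auto
      then show False
        using neg[of y] sin_cos_nonneg_first_quadrant[of m "?th y"] pi_gt_zero
        by (simp add: field_simps)
    next
      case 2
      then obtain y where "x0 lam \<le> y" "?th y = (real m + 1) * pi"
        using IVT'[of ?th "x0 lam" "(real m + 1) * pi" x] m x cont by auto
      then show False
        using neg[of y] sin_cos_nonneg_first_quadrant[of "Suc m" "?th y"] pi_gt_zero
        by (simp add: field_simps)
    qed
  qed
  then show "has_index lam m" using assms by (simp add: has_index_def)
qed

lemma phase_error_pos: "0 < phase_error"
proof -
  have "0 \<le> ((1 + K)\<^sup>2 + (K\<^sup>2 + 1)) * (K\<^sup>2 + 2)"
    by (intro mult_nonneg_nonneg add_nonneg_nonneg) auto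
  then show ?thesis
    unfolding phase_error_def using K_nonneg zero_le_power2[of K] by linarith
qed

lemma ex_theta_gt:
  obtains lam x where "0 \<le> x" "c < theta lam x"
proof -
  define d where "d = \<bar>c\<bar> + 1"
  \<comment> \<open>The spectral parameter will be \<open>l^2\<close>, with square root
    \<open>l\<close>. The factor \<open>3/2\<close> makes the main term \<open>2/3 * l^3\<close>
    exceed the error \<open>phase_error * l^2\<close> by exactly \<open>d * l^2\<close>.\<close>
  define l where "l = 3/2 * (phase_error + d)"
  have d: "1 \<le> d" "c < d" by (auto simp: d_def)
  then have l: "1 \<le> l" using phase_error_pos by (simp add: l_def)
  have l2: "1 \<le> l\<^sup>2" using l by simp
  have "\<bar>theta (l\<^sup>2) (l\<^sup>2 + (K\<^sup>2 + 1)) - 2/3 * l ^ 3\<bar> \<le> phase_error * l\<^sup>2"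
    using theta_at_turning_point[OF l2] l by simp
  moreover have "2/3 * l ^ 3 = phase_error * l\<^sup>2 + l\<^sup>2 * d"
  proof -
    have "2/3 * l = phase_error + d" by (simp add: l_def)
    moreover have "2/3 * l ^ 3 = (2/3 * l) * l\<^sup>2" by (simp add: power3_eq_cube power2_eq_square)
    ultimately show ?thesis by (simp add: algebra_simps)
  qed
  moreover have "1 * d \<le> l\<^sup>2 * d" using l2 d by (intro mult_right_mono) auto
  ultimately have "c < theta (l\<^sup>2) (l\<^sup>2 + (K\<^sup>2 + 1))" using d by linarith
  then show ?thesis by (intro that[of "l\<^sup>2 + (K\<^sup>2 + 1)"]) auto
qed

lemma ex_has_index: "\<exists>lam. has_index lam m"
proof -
  \<comment> \<open>\<open>A\<close> collects the parameters whose angle gets too large,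
    \<open>B\<close> those whose angle is too small somewhere beyond the turning point. Strict
    inequalities make both open and the two barriers make them disjoint, so by connectedness some
    parameter avoids both.\<close>
  define A where "A = (\<Union>x\<in>{0..}. {lam. (real m + 1) * pi < theta lam x})"
  define B where "B = (\<Union>x\<in>{0..}. {lam. lam + (K\<^sup>2 + 1) < x \<and> theta lam x < (real m + 1/2) * pi})"
  have cont: "continuous_on UNIV (\<lambda>lam. theta lam x)" if "0 \<le> x" for x
    using theta_isCont[OF that] by (simp add: continuous_on_eq_continuous_at)
  have "open A"
    unfolding A_def by (intro open_UN ballI open_Collect_less continuous_intros cont) auto
  moreover have "open B"
    unfolding B_def by (intro open_UN ballI open_Collect_conj open_Collect_less continuous_intros cont) auto
  moreover have "A \<inter> B = {}"
  proof (rule ccontr)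
    assume "A \<inter> B \<noteq> {}"
    then obtain lam x y where x: "0 \<le> x" "(real m + 1) * pi < theta lam x"
      and y: "0 \<le> y" "lam + (K\<^sup>2 + 1) < y" "theta lam y < (real m + 1/2) * pi"
      by (auto simp: A_def B_def)
    have "real (Suc m) * pi \<le> theta lam (max x y)"
      by (rule theta_ge_pi_multiple[of x]) (use x in \<open>auto simp: algebra_simps\<close>)
    moreover have "theta lam (max x y) \<le> (real m + 1/2) * pi"
      by (rule theta_le_half_pi_multiple[of lam y]) (use y in \<open>auto simp: x0_def\<close>)
    ultimately show False using pi_gt_zero by (simp add: algebra_simps)
  qed
  moreover have "A \<noteq> {}"
    using ex_theta_gt[of "(real m + 1) * pi"] by (fastforce simp: A_def)
  moreover have "B \<noteq> {}"
  proof -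
    \<comment> \<open>Then \<open>l + K^2 + 1 < 0\<close>, so every point of the half-line lies
      beyond the turning point, and the angle leaves \<open>pi / 2\<close> with slope
      \<open>l < 0\<close>.\<close>
    define l where "l = - (K\<^sup>2 + 2)"
    have "(theta l has_real_derivative l) (at 0 within {0..})"
      using theta_deriv[of 0 l] by (simp add: prufer_rhs_def)
    moreover have "l < 0" unfolding l_def using zero_le_power2[of K] by linarith
    ultimately obtain e where "e > 0" and e: "\<And>h. 0 < h \<Longrightarrow> 0 + h \<in> {0..} \<Longrightarrow> h < e \<Longrightarrow> theta l (0 + h) < theta l 0"
      using has_real_derivative_neg_dec_right by blast
    have "theta l (e/2) < pi / 2" using e[of "e/2"] \<open>e > 0\<close> by simp
    moreover have "pi / 2 \<le> (real m + 1/2) * pi" by (simp add: algebra_simps)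
    ultimately have "theta l (e/2) < (real m + 1/2) * pi" by linarith
    moreover have "l + (K\<^sup>2 + 1) < e/2" using \<open>e > 0\<close> by (simp add: l_def)
    ultimately have "l \<in> B" unfolding B_def using \<open>e > 0\<close> by (intro UN_I[of "e/2"]) auto
    then show ?thesis by auto
  qed
  ultimately have "A \<union> B \<noteq> UNIV"
    using connected_UNIV[where 'a=real] unfolding connected_def by (metis Int_UNIV_right inf_commute subset_UNIV order_refl)
  then obtain lam where lam: "lam \<notin> A" "lam \<notin> B" by auto
  then have up: "theta lam x \<le> (real m + 1) * pi" if "0 \<le> x" for x
    using that by (force simp: A_def)
  have low: "(real m + 1/2) * pi \<le> theta lam x" if "x0 lam < x" for x
  proof -
    have "0 \<le> x" "lam + (K\<^sup>2 + 1) < x" using that by (auto simp: x0_def)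
    then have "lam \<in> B" if "theta lam x < (real m + 1/2) * pi"
      using that unfolding B_def by blast
    then show ?thesis using lam(2) by (meson not_less)
  qed
  have eig: "lam \<in> eigenvalues_N q"
  proof (rule eigenvalueI)
    fix x assume x: "x0 lam < x"
    then have "sin (theta lam x) * cos (theta lam x) \<le> 0"
      using up[of x] low[of x] x0_nonneg[of lam] by (intro sin_cos_nonpos_second_quadrant[of m]) auto
    then show "u lam x * v lam x \<le> 0" unfolding uv_eq by (rule mult_nonneg_nonpos[OF zero_le_power2])
  qed
  \<comment> \<open>Avoiding \<open>A\<close> and \<open>B\<close> yields only closed bounds. The
    open ones come from the index \<open>n\<close> of \<open>lam\<close>, and the intervals for
    \<open>n\<close> and \<open>m\<close> can overlap only if \<open>n = m\<close>.\<close>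
  then obtain n where n: "has_index lam n" using eigenvalue_has_index by blast
  then have "(real n + 1/2) * pi < theta lam (x0 lam + 1)" "theta lam (x0 lam + 1) < (real n + 1) * pi"
    by (auto simp: has_index_def)
  then have "(real n + 1/2) * pi < (real m + 1) * pi" "(real m + 1/2) * pi < (real n + 1) * pi"
    using up[of "x0 lam + 1"] low[of "x0 lam + 1"] x0_nonneg[of lam] by linarith+
  then have "real n + 1/2 < real m + 1" "real m + 1/2 < real n + 1" by simp_all
  then have "n = m" by linarith
  with n show ?thesis by blast
qed

text \<open>Two eigenvalues with the same index would have eigenfunctions of equal sign beyond the turning
  point, so that their Wronskian would increase from a positive value and could not tend to \<open>0\<close>.\<close>

lemma has_index_unique_aux:
  assumes "has_index lam m" "has_index lam' m"
  shows "\<not> lam < lam'"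
proof
  assume less: "lam < lam'"
  define a where "a = x0 lam' + 1"
  have a: "x0 lam \<le> a" "x0 lam' \<le> a" "0 < a" using less by (auto simp: a_def x0_def)
  have idx: "(real m + 1/2) * pi < theta lam x" "theta lam x < (real m + 1) * pi"
    "(real m + 1/2) * pi < theta lam' x" "theta lam' x < (real m + 1) * pi" if "a \<le> x" for x
    using assms that a by (auto simp: has_index_def)
  define W where "W x = u lam' x * v lam x - u lam x * v lam' x" for x
  have dW: "(W has_real_derivative (lam' - lam) * (u lam x * u lam' x)) (at x within {0..})"
    if "0 \<le> x" for x
    unfolding W_def
    by (rule DERIV_cong[OF DERIV_diff[OF DERIV_mult[OF u_deriv v_deriv] DERIV_mult[OF u_deriv v_deriv]]])
      (simp_all add: that power2_eq_square algebra_simps)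
  have mono: "W a \<le> W x" if "a \<le> x" for x
  proof (rule deriv_within_nonneg_mono[OF that, of "{0..}", OF _ dW])
    fix y assume y: "y \<in> {a..x}"
    have "0 < sin (theta lam y) * sin (theta lam' y)"
      using idx[of y] y by (intro sin_mult_sin_pos[of m]) (auto simp: algebra_simps)
    then have "0 < (amp lam y * amp lam' y) * (sin (theta lam y) * sin (theta lam' y))"
      by (rule mult_pos_pos[OF mult_pos_pos[OF amp_pos amp_pos]])
    then have "0 < u lam y * u lam' y" by (simp add: u_def mult_ac)
    then show "0 \<le> (lam' - lam) * (u lam y * u lam' y)" using less by simp
  qed (use a in auto)
  \<comment> \<open>A product of amplitudes and the sine of the difference of angles. Both angles
    lie in the same quadrant and the one for \<open>lam'\<close> is larger, so the sine is
    positive.\<close>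
  have "W a = amp lam a * amp lam' a * sin (theta lam' a - theta lam a)"
    by (simp add: W_def u_def v_def sin_diff algebra_simps)
  moreover have "0 < sin (theta lam' a - theta lam a)"
    using theta_strict_mono[OF less a(3)] idx[of a] by (intro sin_gt_zero) (auto simp: algebra_simps)
  ultimately have "0 < W a" by (simp add: amp_pos)
  let ?f = "\<lambda>x. ((u lam x)\<^sup>2 + (v lam x)\<^sup>2) + ((u lam' x)\<^sup>2 + (v lam' x)\<^sup>2)"
  have cont: "continuous_on {0..} (\<lambda>x. (u l x)\<^sup>2 + (v l x)\<^sup>2)" for l
    by (intro continuous_intros u_cont v_cont)
  \<comment> \<open>\<open>?f\<close> dominates \<open>W\<close> and has bounded integrals, since
    \<open>u * v\<close> is nonpositive for both eigenvalues; a point where it drops below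
    \<open>W a\<close> contradicts the growth of \<open>W\<close>.\<close>
  have "\<exists>x\<ge>a. a \<le> x \<and> ?f x < W a"
  proof (rule small_value_of_bounded_integral[where B = "- (u lam a * v lam a) - u lam' a * v lam' a"])
    show "continuous_on {a..} ?f"
      by (rule continuous_on_subset[OF continuous_on_add[OF cont cont]]) (use a in auto)
    fix x assume x: "a \<le> x"
    have "integral {a..x} ?f = integral {a..x} (\<lambda>x. (u lam x)\<^sup>2 + (v lam x)\<^sup>2)
        + integral {a..x} (\<lambda>x. (u lam' x)\<^sup>2 + (v lam' x)\<^sup>2)"
      using a by (intro integral_add continuous_integrable_Icc[OF cont]) auto
    also have "\<dots> \<le> (u lam x * v lam x - u lam a * v lam a) + (u lam' x * v lam' x - u lam' a * v lam' a)"
      using a x by (intro add_mono integral_u2_v2_le) auto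
    also have "\<dots> \<le> - (u lam a * v lam a) - u lam' a * v lam' a"
      using eigenvalue_uv_nonpos[of lam x] eigenvalue_uv_nonpos[of lam' x] assms a x
      by (simp add: has_index_def)
    finally show "integral {a..x} ?f \<le> - (u lam a * v lam a) - u lam' a * v lam' a" .
  qed (use \<open>0 < W a\<close> in auto)
  then obtain x where x: "a \<le> x" "?f x < W a" by blast
  have "W x \<le> ?f x"
  proof -
    have "2 * (p * r) \<le> p\<^sup>2 + r\<^sup>2" "- 2 * (p * r) \<le> p\<^sup>2 + r\<^sup>2" for p r :: real
      using zero_le_power2[of "p - r"] zero_le_power2[of "p + r"]
      by (auto simp: power2_diff power2_sum)
    from this(1)[of "u lam' x" "v lam x"] this(2)[of "u lam x" "v lam' x"]
    show ?thesis
      using zero_le_power2[of "u lam' x"] zero_le_power2[of "v lam' x"]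
        zero_le_power2[of "u lam x"] zero_le_power2[of "v lam x"]
      unfolding W_def by linarith
  qed
  then show False using mono[OF x(1)] x(2) by simp
qed

lemma has_index_unique: "has_index lam m \<Longrightarrow> has_index lam' m \<Longrightarrow> lam = lam'"
  using has_index_unique_aux by (meson linorder_neqE)

section \<open>From indices to the ordering of the eigenvalues\<close>

definition mu :: "nat \<Rightarrow> real" where "mu m = (SOME lam. has_index lam m)"

lemma mu_index: "has_index (mu m) m"
  unfolding mu_def by (rule someI_ex[OF ex_has_index])

text \<open>At a point beyond both turning points a larger index means a larger angle, and the angle
  is monotone in the spectral parameter.\<close>

lemma mu_strict_mono: "strict_mono mu"
proof (rule strict_monoI, rule ccontr)
  fix m n :: nat assume "m < n" "\<not> mu m < mu n"
  define x where "x = x0 (mu m)"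
  have "x0 (mu n) \<le> x" using \<open>\<not> mu m < mu n\<close> by (auto simp: x_def x0_def)
  then have "(real n + 1/2) * pi < theta (mu n) x" using mu_index[of n] by (simp add: has_index_def)
  also have "\<dots> \<le> theta (mu m) x"
    by (rule theta_mono) (use \<open>\<not> mu m < mu n\<close> x0_nonneg in \<open>auto simp: x_def\<close>)
  also have "\<dots> < (real m + 1) * pi" using mu_index[of m] by (simp add: has_index_def x_def)
  finally have "real n + 1/2 < real m + 1" by simp
  then show False using \<open>m < n\<close> by linarith
qed

lemma eigenvalues_eq_range: "eigenvalues_N q = range mu"
proof
  show "eigenvalues_N q \<subseteq> range mu"
    using eigenvalue_has_index has_index_unique mu_index by (metis rangeI subsetI)
  show "range mu \<subseteq> eigenvalues_N q" using mu_index by (auto simp: has_index_def)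
qed

text \<open>Indices start at \<open>0\<close>, eigenvalues at \<open>1\<close>: \<open>mu m\<close>
  has exactly \<open>m = Suc m - 1\<close> eigenvalues below it, and this number determines
  it.\<close>

lemma eigenvalue_N_eq: "eigenvalue_N q (Suc m) = mu m"
proof -
  have card: "card {l \<in> eigenvalues_N q. l < mu n} = n" for n
  proof -
    have "{l \<in> eigenvalues_N q. l < mu n} = mu ` {..<n}"
      using strict_mono_less[OF mu_strict_mono] by (auto simp: eigenvalues_eq_range)
    then show ?thesis
      using card_image[of mu "{..<n}"] strict_mono_imp_inj_on[OF mu_strict_mono]
      by (metis card_lessThan inj_on_subset subset_UNIV)
  qed
  show ?thesis
    unfolding eigenvalue_N_def using card
    by (intro the_equality) (auto simp: eigenvalues_eq_range)
qed

lemma inv_norming_const_N_eq: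
  "inv_norming_const_N q (Suc m) = integral {0..} (\<lambda>x. (u (mu m) x)\<^sup>2)"
proof -
  have "\<exists>phi. is_eigenfunction_N q (mu m) phi"
    using mu_index[of m] by (simp add: has_index_def eigenvalues_N_def)
  from eigenfunction_quotient[OF someI_ex[OF this]] show ?thesis
    by (simp add: inv_norming_const_N_def eigenvalue_N_eq Let_def)
qed

lemma mu_phase:
  assumes "1 \<le> mu m"
  shows "\<bar>real m * pi - 2/3 * sqrt (mu m) ^ 3\<bar> \<le> (phase_error + 4) * mu m"
proof -
  have "x0 (mu m) = mu m + (K\<^sup>2 + 1)" using assms by (simp add: x0_def add_increasing)
  then have "(real m + 1/2) * pi < theta (mu m) (mu m + (K\<^sup>2 + 1))"
    "theta (mu m) (mu m + (K\<^sup>2 + 1)) < (real m + 1) * pi"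
    using mu_index[of m] by (auto simp: has_index_def)
  then have "\<bar>theta (mu m) (mu m + (K\<^sup>2 + 1)) - real m * pi\<bar> \<le> 4"
    using pi_less_4 pi_gt_zero by (simp add: distrib_right abs_le_iff)
  then have "\<bar>real m * pi - 2/3 * sqrt (mu m) ^ 3\<bar> \<le> phase_error * mu m + 4"
    using theta_at_turning_point[OF assms] by linarith
  also have "\<dots> \<le> (phase_error + 4) * mu m" using assms by (simp add: algebra_simps)
  finally show ?thesis .
qed

text \<open>An upper bound \<open>c\<close> for \<open>mu\<close> would bound all angles at
  \<open>x0 c\<close> by \<open>theta c (x0 c)\<close>, while the angle of index \<open>m\<close>
  exceeds \<open>m * pi\<close> there.\<close>

lemma mu_at_top: "filterlim mu at_top sequentially"
proof -
  have "\<exists>m. c < mu m" for c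
  proof (rule ccontr)
    assume "\<not> ?thesis"
    then have le: "mu m \<le> c" for m by (simp add: not_less)
    obtain m :: nat where m: "theta c (x0 c) / pi < real m" using reals_Archimedean2 by blast
    have "x0 (mu m) \<le> x0 c" using le[of m] by (auto simp: x0_def)
    then have "(real m + 1/2) * pi < theta (mu m) (x0 c)" using mu_index[of m] by (simp add: has_index_def)
    also have "\<dots> \<le> theta c (x0 c)" by (rule theta_mono[OF le x0_nonneg])
    also have "\<dots> < real m * pi" using m by (simp add: field_simps)
    finally show False by simp
  qed
  then show ?thesis
    unfolding filterlim_at_top_gt[where c=0] eventually_sequentially
    using strict_mono_less_eq[OF mu_strict_mono] by (meson less_imp_le order_trans)
qed

subsection \<open>Asymptotics\<close>

lemma du_cont: "continuous_on {0..} (du lam)"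
  unfolding du_def by (intro continuous_intros Q_cont u_cont v_cont)

text \<open>Formed with \<open>u'\<close> and not with \<open>v\<close>: the terms
  \<open>2 * (x - lam) * u * u'\<close> in the derivative then cancel, and \<open>q\<close> survives
  only with the factor \<open>2 * u * u'\<close>.\<close>

definition energy :: "real \<Rightarrow> real \<Rightarrow> real" where
  "energy lam x = (du lam x)\<^sup>2 + (lam - x) * (u lam x)\<^sup>2"

lemma energy_0: "energy lam 0 = lam"
  by (simp add: energy_def du_def)

lemma energy_cont: "continuous_on {0..} (energy lam)"
  unfolding energy_def by (intro continuous_intros du_cont u_cont)

lemma energy_AC: "loc_AC_deriv (energy lam) (\<lambda>x. - (u lam x)\<^sup>2 + q x * (2 * (u lam x * du lam x)))"
proof -
  have "loc_AC_deriv (\<lambda>x. lam - x) (\<lambda>x. - 1)"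
    by (rule loc_AC_deriv_of_C1) (auto intro!: derivative_eq_intros)
  from loc_AC_deriv_add[OF loc_AC_deriv_mult[OF du_AC[of lam] du_AC[of lam]]
      loc_AC_deriv_mult[OF this loc_AC_deriv_mult[OF u_AC[of lam] u_AC[of lam]]]]
  have "loc_AC_deriv (\<lambda>x. du lam x * du lam x + (lam - x) * (u lam x * u lam x))
      (\<lambda>x. - (u lam x)\<^sup>2 + q x * (2 * (u lam x * du lam x)))"
    by (rule loc_AC_deriv_cong_AE) (simp add: power2_eq_square algebra_simps)
  then show ?thesis unfolding energy_def power2_eq_square .
qed

lemma energy_diff:
  assumes "0 \<le> a" "a \<le> b" and M: "\<And>x. x \<in> {a..b} \<Longrightarrow> 2 * \<bar>u lam x * du lam x\<bar> \<le> M"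
  shows "\<bar>energy lam b - energy lam a + integral {a..b} (\<lambda>x. (u lam x)\<^sup>2)\<bar>
    \<le> M * integral {a..b} (\<lambda>x. \<bar>q x\<bar>)"
proof -
  let ?g = "\<lambda>x. q x * (2 * (u lam x * du lam x))"
  have int_u: "(\<lambda>x. (u lam x)\<^sup>2) integrable_on {a..b}"
    by (rule continuous_integrable_Icc[OF _ assms(1)]) (intro continuous_intros u_cont)
  have "continuous_on {0..} (\<lambda>x. 2 * (u lam x * du lam x))"
    by (intro continuous_intros u_cont du_cont)
  then have "(\<lambda>x. (2 * (u lam x * du lam x)) * q x) absolutely_integrable_on {a..b}"
    using assms(1)
    by (intro absolutely_integrable_continuous_mult q_int_Icc) (auto intro: continuous_on_subset)
  then have int_g: "?g integrable_on {a..b}"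
    using absolutely_integrable_on_realD(1) by (simp add: mult.commute)
  have "energy lam b - energy lam a = integral {a..b} (\<lambda>x. - (u lam x)\<^sup>2 + ?g x)"
    by (rule loc_AC_deriv_diff[OF energy_AC assms(1,2)])
  also have "\<dots> = - integral {a..b} (\<lambda>x. (u lam x)\<^sup>2) + integral {a..b} ?g"
    using integral_add[OF integrable_neg[OF int_u] int_g] by simp
  finally have "energy lam b - energy lam a + integral {a..b} (\<lambda>x. (u lam x)\<^sup>2) = integral {a..b} ?g"
    by simp
  moreover have "norm (integral {a..b} ?g) \<le> integral {a..b} (\<lambda>x. M * \<bar>q x\<bar>)"
  proof (rule integral_norm_bound_integral[OF int_g])
    show "(\<lambda>x. M * \<bar>q x\<bar>) integrable_on {a..b}"
      by (intro integrable_on_mult_right absolutely_integrable_on_realD(2) q_int_Icc assms)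
    fix x assume "x \<in> {a..b}"
    then have "\<bar>q x\<bar> * (2 * \<bar>u lam x * du lam x\<bar>) \<le> \<bar>q x\<bar> * M"
      using M by (intro mult_left_mono) auto
    then show "norm (?g x) \<le> M * \<bar>q x\<bar>" by (simp add: abs_mult mult_ac)
  qed
  ultimately show ?thesis by simp
qed

lemma energy_diff_le:
  assumes "0 \<le> a" "a \<le> b" "\<And>x. x \<in> {a..b} \<Longrightarrow> 2 * \<bar>u lam x * du lam x\<bar> \<le> M"
  shows "energy lam b - energy lam a \<le> M * integral {a..b} (\<lambda>x. \<bar>q x\<bar>)"
proof -
  have "0 \<le> integral {a..b} (\<lambda>x. (u lam x)\<^sup>2)"
    by (intro integral_nonneg continuous_integrable_Icc) (auto intro!: continuous_intros u_cont assms)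
  then show ?thesis using energy_diff[OF assms] by linarith
qed

text \<open>The arithmetic-geometric mean inequality for the two squares of the energy; the factor
  \<open>sqrt (lam - x)\<close> is the gain over the trivial bound.\<close>

lemma u_du_le_energy:
  assumes "x \<le> lam"
  shows "sqrt (lam - x) * (2 * \<bar>u lam x * du lam x\<bar>) \<le> energy lam x"
proof -
  define s where "s = sqrt (lam - x)"
  have s: "0 \<le> s" "s\<^sup>2 = lam - x" using assms by (auto simp: s_def)
  have "0 \<le> (\<bar>du lam x\<bar> - s * \<bar>u lam x\<bar>)\<^sup>2" by simp
  also have "\<dots> = (du lam x)\<^sup>2 + s\<^sup>2 * (u lam x)\<^sup>2 - s * (2 * \<bar>u lam x * du lam x\<bar>)"
    by (simp add: power2_diff power_mult_distrib abs_mult algebra_simps)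
  finally show ?thesis
    unfolding energy_def s_def[symmetric] unfolding s(2)[symmetric] by simp
qed

lemma u_du_le_energy_left:
  assumes "0 \<le> S" "energy lam x \<le> S" "0 < lam" "x \<le> lam / 2"
  shows "2 * \<bar>u lam x * du lam x\<bar> \<le> S / sqrt (lam / 2)"
proof -
  have "sqrt (lam / 2) * (2 * \<bar>u lam x * du lam x\<bar>) \<le> sqrt (lam - x) * (2 * \<bar>u lam x * du lam x\<bar>)"
    using assms by (intro mult_right_mono) auto
  also have "\<dots> \<le> S" using u_du_le_energy[of x lam] assms by simp
  finally show ?thesis using assms by (simp add: field_simps)
qed

lemma u_du_le_energy_mid:
  assumes "energy lam x \<le> S" "x \<le> lam - 1"
  shows "2 * \<bar>u lam x * du lam x\<bar> \<le> S"
proof -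
  have "1 * (2 * \<bar>u lam x * du lam x\<bar>) \<le> sqrt (lam - x) * (2 * \<bar>u lam x * du lam x\<bar>)"
    using assms by (intro mult_right_mono) auto
  then show ?thesis using u_du_le_energy[of x lam] assms by simp
qed

text \<open>A bootstrap on the maximum \<open>S\<close> of the energy over
  \<open>{0..lam - 1}\<close>. Up to \<open>lam / 2\<close> the perturbation adds at most
  \<open>S / sqrt (lam / 2) * K \<le> S / 4\<close>, afterwards at most \<open>S\<close> times the
  tail of \<open>q\<close>, again \<open>S / 4\<close>. Hence
  \<open>S \<le> lam + S / 2\<close>.\<close>

lemma energy_bound:
  assumes lam: "4 \<le> lam" "K \<le> sqrt (lam / 2) / 4"
    and tail: "\<And>b. integral {lam/2..b} (\<lambda>x. \<bar>q x\<bar>) \<le> 1/4"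
    and x: "x \<in> {0..lam - 1}"
  shows "energy lam x \<le> 2 * lam"
proof -
  have "\<exists>t\<in>{0..lam - 1}. \<forall>y\<in>{0..lam - 1}. energy lam y \<le> energy lam t"
    by (rule continuous_attains_sup) (use lam in \<open>auto intro: continuous_on_subset[OF energy_cont]\<close>)
  then obtain t where t: "t \<in> {0..lam - 1}"
    and max: "\<And>y. y \<in> {0..lam - 1} \<Longrightarrow> energy lam y \<le> energy lam t" by blast
  define S where "S = energy lam t"
  have S: "0 \<le> S" unfolding S_def energy_def using t by simp
  have sq: "0 < sqrt (lam / 2)" using lam by simp
  have left: "energy lam y \<le> lam + S / 4" if y: "0 \<le> y" "y \<le> lam / 2" for y
  proof -
    have "energy lam y - energy lam 0 \<le> (S / sqrt (lam / 2)) * integral {0..y} (\<lambda>x. \<bar>q x\<bar>)"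
      by (rule energy_diff_le) (use y lam S max in \<open>auto intro!: u_du_le_energy_left simp: S_def\<close>)
    also have "\<dots> \<le> (S / sqrt (lam / 2)) * (sqrt (lam / 2) / 4)"
      using integral_abs_q_le[of 0 y] lam(2) S sq by (intro mult_left_mono) auto
    also have "\<dots> = S / 4" using sq by (simp add: field_simps)
    finally show ?thesis by (simp add: energy_0)
  qed
  have "S \<le> lam + S / 4 + S / 4"
  proof (cases "t \<le> lam / 2")
    case True
    then show ?thesis using left[of t] t S by (simp add: S_def)
  next
    case False
    have "energy lam t - energy lam (lam / 2) \<le> S * integral {lam / 2..t} (\<lambda>x. \<bar>q x\<bar>)"
      by (rule energy_diff_le)
        (use False lam t max in \<open>auto intro!: u_du_le_energy_mid simp: S_def\<close>)
    also have "\<dots> \<le> S * (1/4)" using tail S by (intro mult_left_mono)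
    finally show ?thesis using left[of "lam / 2"] lam by (simp add: S_def)
  qed
  then have "S \<le> 2 * lam" by simp
  then show ?thesis using max[OF x] by (simp add: S_def)
qed

section \<open>Bounds near and beyond the turning point\<close>

definition growth :: real where
  "growth = (4 + 4 * K\<^sup>2) * exp ((2 * K + 1 + (K\<^sup>2 + 1) + K\<^sup>2) * (K\<^sup>2 + 2))"

lemma growth_pos: "0 < growth"
  by (auto simp: growth_def intro!: mult_pos_pos add_pos_nonneg)

text \<open>At \<open>lam - 1\<close> the energy equals \<open>u'^2 + u^2\<close>, so it controls
  \<open>u\<close> and \<open>v = u' - Q * u\<close>. Gronwall carries this over a window whose
  width \<open>K^2 + 2\<close> and growth rate do not depend on \<open>lam\<close>.\<close>

lemma u2_v2_near_turning_point:
  assumes lam: "1 \<le> lam" and E: "energy lam (lam - 1) \<le> 2 * lam"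
    and x: "x \<in> {lam - 1..lam + (K\<^sup>2 + 1)}"
  shows "(u lam x)\<^sup>2 + (v lam x)\<^sup>2 \<le> growth * lam"
proof -
  define L where "L = 2 * K + 1 + (K\<^sup>2 + 1) + K\<^sup>2"
  define a where "a = lam - 1"
  let ?F = "\<lambda>x. (u lam x)\<^sup>2 + (v lam x)\<^sup>2"
  have a: "0 \<le> a" using lam by (simp add: a_def)
  have "0 \<le> L" using K_nonneg by (simp add: L_def)
  have "(v lam a)\<^sup>2 \<le> 2 * (du lam a)\<^sup>2 + 2 * ((Q a)\<^sup>2 * (u lam a)\<^sup>2)"
    using zero_le_power2[of "du lam a + Q a * u lam a"]
    by (simp add: du_def power2_sum power_mult_distrib algebra_simps power2_eq_square)
  moreover have "(Q a)\<^sup>2 * (u lam a)\<^sup>2 \<le> K\<^sup>2 * (u lam a)\<^sup>2"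
    using Q_power2_bound[OF a] by (intro mult_right_mono) auto
  moreover have "(du lam a)\<^sup>2 + (u lam a)\<^sup>2 \<le> 2 * lam" using E by (simp add: energy_def a_def)
  then have "(2 + 2 * K\<^sup>2) * ((du lam a)\<^sup>2 + (u lam a)\<^sup>2) \<le> (2 + 2 * K\<^sup>2) * (2 * lam)"
    by (intro mult_left_mono) auto
  moreover have "0 \<le> K\<^sup>2 * (du lam a)\<^sup>2" by simp
  moreover have "0 \<le> (u lam a)\<^sup>2" by simp
  moreover have "(2 + 2 * K\<^sup>2) * ((du lam a)\<^sup>2 + (u lam a)\<^sup>2)
      = 2 * (du lam a)\<^sup>2 + 2 * (u lam a)\<^sup>2 + 2 * (K\<^sup>2 * (du lam a)\<^sup>2) + 2 * (K\<^sup>2 * (u lam a)\<^sup>2)"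
    "(2 + 2 * K\<^sup>2) * (2 * lam) = (4 + 4 * K\<^sup>2) * lam"
    by (simp_all add: algebra_simps)
  ultimately have Fa: "?F a \<le> (4 + 4 * K\<^sup>2) * lam" by linarith
  have "?F x \<le> ?F a * exp (L * (x - a))"
  proof (rule gronwall_within[of _ _ "{0..}"])
    fix y assume y: "y \<in> {a..x}"
    show "(?F has_real_derivative 2 * u lam y * (Q y * u lam y + v lam y)
        + 2 * v lam y * ((y - lam - (Q y)\<^sup>2) * u lam y - Q y * v lam y)) (at y within {0..})"
      using y a by (auto intro!: derivative_eq_intros u_deriv v_deriv)
    have "\<bar>y - lam\<bar> \<le> K\<^sup>2 + 1" using y x by (auto simp: a_def abs_le_iff add_increasing)
    then show "2 * u lam y * (Q y * u lam y + v lam y)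
        + 2 * v lam y * ((y - lam - (Q y)\<^sup>2) * u lam y - Q y * v lam y) \<le> L * ?F y"
      unfolding L_def by (rule sum_squares_deriv_le[rotated]) (use y a Q_bound in auto)
  qed (use x a in \<open>auto simp: a_def\<close>)
  also have "\<dots> \<le> ((4 + 4 * K\<^sup>2) * lam) * exp (L * (K\<^sup>2 + 2))"
  proof (intro mult_mono Fa)
    have "L * (x - a) \<le> L * (K\<^sup>2 + 2)"
      using x \<open>0 \<le> L\<close> by (intro mult_left_mono) (auto simp: a_def)
    then show "exp (L * (x - a)) \<le> exp (L * (K\<^sup>2 + 2))" by simp
  qed (use lam in auto)
  finally show ?thesis by (simp add: growth_def L_def mult_ac)
qed

text \<open>Beyond \<open>x0 lam\<close> the product \<open>u * v\<close> is nonpositive and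
  increasing, so its modulus and the integral of \<open>u^2\<close> are bounded by its modulus at
  \<open>x0 lam\<close>. Integrating \<open>(u^2)' \<le> 2 * K * u^2\<close> then bounds
  \<open>u^2\<close>, and \<open>u * u' = Q * u^2 + u * v\<close>.\<close>

lemma u_du_right_bound:
  assumes eig: "lam \<in> eigenvalues_N q" and lam: "1 \<le> lam"
    and E: "energy lam (lam - 1) \<le> 2 * lam" and x: "lam - 1 \<le> x"
  shows "2 * \<bar>u lam x * du lam x\<bar> \<le> 2 * (K + 1) * ((1 + 2 * K) * growth * lam)"
proof -
  define G where "G = growth * lam"
  define b where "b = lam + (K\<^sup>2 + 1)"
  have b: "x0 lam = b" "lam - 1 \<le> b" "0 \<le> b" using lam by (auto simp: b_def x0_def add_increasing)
  have "0 \<le> x" using x lam by simp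
  have G: "0 \<le> G" using growth_pos lam by (simp add: G_def)
  have G_le: "G \<le> (1 + 2 * K) * G"
    using mult_right_mono[of 1 "1 + 2 * K" G] K_nonneg G by simp
  have near: "(u lam y)\<^sup>2 + (v lam y)\<^sup>2 \<le> G" if "y \<in> {lam - 1..b}" for y
    unfolding G_def using u2_v2_near_turning_point[OF lam E] that by (simp add: b_def)
  have "(u lam x)\<^sup>2 \<le> (1 + 2 * K) * G \<and> \<bar>u lam x * v lam x\<bar> \<le> G"
  proof (cases "x \<le> b")
    case True
    then have "(u lam x)\<^sup>2 + (v lam x)\<^sup>2 \<le> G" using near x by simp
    then show ?thesis
      using abs_mult_le_sum_squares[of "u lam x" "v lam x"] zero_le_power2[of "v lam x"] G_le by linarith
  next
    case False
    have uvb: "\<bar>u lam b * v lam b\<bar> \<le> G"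
      using abs_mult_le_sum_squares[of "u lam b" "v lam b"] near[of b] b by simp
    have neg: "u lam y * v lam y \<le> 0" if "b \<le> y" for y
      using eigenvalue_uv_nonpos[OF eig, of y] that b by simp
    have cont: "continuous_on {0..} (\<lambda>x. (u lam x)\<^sup>2)" by (intro continuous_intros u_cont)
    let ?J = "\<lambda>x. integral {0..x} (\<lambda>x. (u lam x)\<^sup>2)"
    have "(u lam x)\<^sup>2 - (u lam b)\<^sup>2 \<le> 2 * K * ?J x - 2 * K * ?J b"
    proof (rule deriv_within_diff_le[of _ _ "{0..}"])
      fix y assume y: "y \<in> {b..x}"
      then have "0 \<le> y" using b by simp
      show "((\<lambda>x. (u lam x)\<^sup>2) has_real_derivative 2 * u lam y * (Q y * u lam y + v lam y))
          (at y within {0..})"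
        by (auto intro!: derivative_eq_intros u_deriv \<open>0 \<le> y\<close>)
      show "((\<lambda>x. 2 * K * ?J x) has_real_derivative 2 * K * (u lam y)\<^sup>2) (at y within {0..})"
        by (rule DERIV_cmult integral_has_real_derivative_atLeast cont \<open>0 \<le> y\<close>)+
      have "Q y * (u lam y)\<^sup>2 \<le> K * (u lam y)\<^sup>2"
        using Q_bound[OF \<open>0 \<le> y\<close>] by (intro mult_right_mono) auto
      then show "2 * u lam y * (Q y * u lam y + v lam y) \<le> 2 * K * (u lam y)\<^sup>2"
        using neg[of y] y by (simp add: power2_eq_square algebra_simps)
    qed (use False b in auto)
    also have "\<dots> = 2 * K * integral {b..x} (\<lambda>x. (u lam x)\<^sup>2)"
    proof -
      have "?J b + integral {b..x} (\<lambda>x. (u lam x)\<^sup>2) = ?J x"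
        by (rule Henstock_Kurzweil_Integration.integral_combine)
          (use False b in \<open>auto intro!: continuous_integrable_Icc cont\<close>)
      then have "integral {b..x} (\<lambda>x. (u lam x)\<^sup>2) = ?J x - ?J b" by simp
      then show ?thesis by (simp only: right_diff_distrib)
    qed
    also have "\<dots> \<le> 2 * K * G"
    proof (rule mult_left_mono)
      have "integral {b..x} (\<lambda>x. (u lam x)\<^sup>2) \<le> integral {b..x} (\<lambda>x. (u lam x)\<^sup>2 + (v lam x)\<^sup>2)"
        by (intro integral_le continuous_integrable_Icc)
          (auto intro!: continuous_intros u_cont v_cont simp: b)
      also have "\<dots> \<le> u lam x * v lam x - u lam b * v lam b"
        by (rule integral_u2_v2_le) (use b False in auto)
      also have "\<dots> \<le> G" using neg[of x] uvb False by linarith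
      finally show "integral {b..x} (\<lambda>x. (u lam x)\<^sup>2) \<le> G" .
    qed (use K_nonneg in auto)
    finally have "(u lam x)\<^sup>2 \<le> (u lam b)\<^sup>2 + 2 * K * G" by simp
    moreover have "(u lam b)\<^sup>2 \<le> G" using near[of b] b by (auto intro: order_trans[rotated])
    moreover have "\<bar>u lam x * v lam x\<bar> \<le> G"
      using uv_strict_mono[of lam b x] b False neg[of x] uvb by simp
    ultimately show ?thesis by (simp add: algebra_simps)
  qed
  then have *: "(u lam x)\<^sup>2 \<le> (1 + 2 * K) * G" "\<bar>u lam x * v lam x\<bar> \<le> (1 + 2 * K) * G"
    using G_le by auto
  have "\<bar>Q x * (u lam x)\<^sup>2\<bar> \<le> K * ((1 + 2 * K) * G)"
    unfolding abs_mult using Q_bound[OF \<open>0 \<le> x\<close>] * K_nonneg by (intro mult_mono) auto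
  moreover have "u lam x * du lam x = Q x * (u lam x)\<^sup>2 + u lam x * v lam x"
    by (simp add: du_def power2_eq_square algebra_simps)
  ultimately have "\<bar>u lam x * du lam x\<bar> \<le> K * ((1 + 2 * K) * G) + (1 + 2 * K) * G"
    using * by linarith
  then have "2 * \<bar>u lam x * du lam x\<bar> \<le> 2 * (K * ((1 + 2 * K) * G) + (1 + 2 * K) * G)"
    by (rule mult_left_mono) simp
  also have "\<dots> = 2 * (K + 1) * ((1 + 2 * K) * growth * lam)"
    by (simp add: G_def algebra_simps)
  finally show ?thesis .
qed

text \<open>The weight \<open>lam - x\<close> is unbounded, so smallness of \<open>u^2 + v^2\<close>
  would not suffice. The derivative of \<open>u * v\<close> carries the same weight, has bounded
  integrals, and dominates every term of the energy up to the factor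
  \<open>3 + 3 * K^2\<close>.\<close>

lemma energy_small:
  assumes eig: "lam \<in> eigenvalues_N q" and "0 < e"
  shows "\<exists>x\<ge>0. y \<le> x \<and> \<bar>energy lam x\<bar> < e"
proof -
  let ?h = "\<lambda>x. (v lam x)\<^sup>2 + (x - lam - (Q x)\<^sup>2) * (u lam x)\<^sup>2"
  have K1: "0 < 3 + 3 * K\<^sup>2" by (intro add_pos_nonneg) auto
  have "\<exists>x\<ge>x0 lam. y \<le> x \<and> ?h x < e / (3 + 3 * K\<^sup>2)"
  proof (rule small_value_of_bounded_integral[where B = "- (u lam (x0 lam) * v lam (x0 lam))"])
    show "continuous_on {x0 lam..} ?h"
      by (rule continuous_on_subset[of "{0..}"])
        (auto intro!: continuous_intros Q_cont u_cont v_cont simp: x0_nonneg)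
    show "integral {x0 lam..x} ?h \<le> - (u lam (x0 lam) * v lam (x0 lam))" if "x0 lam \<le> x" for x
      using integral_uv_deriv[OF x0_nonneg that] eigenvalue_uv_nonpos[OF eig that] by simp
    show "0 \<le> ?h x" if "x0 lam \<le> x" for x
      using uv_deriv_ge[OF that] zero_le_power2[of "u lam x"] zero_le_power2[of "v lam x"] by linarith
  qed (use K1 \<open>0 < e\<close> in auto)
  then obtain x where x: "x0 lam \<le> x" "y \<le> x" "?h x < e / (3 + 3 * K\<^sup>2)" by blast
  have "0 \<le> x" using x x0_nonneg[of lam] by simp
  let ?p = "(x - lam - (Q x)\<^sup>2) * (u lam x)\<^sup>2"
  have u: "(u lam x)\<^sup>2 \<le> ?p" using uv_deriv_ge[OF x(1)] by simp
  then have p: "0 \<le> ?p" using order_trans zero_le_power2 by blast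
  have "(Q x)\<^sup>2 * (u lam x)\<^sup>2 \<le> K\<^sup>2 * ?p"
    using Q_power2_bound[OF \<open>0 \<le> x\<close>] u by (intro mult_mono) auto
  moreover have "(du lam x)\<^sup>2 \<le> 2 * (v lam x)\<^sup>2 + 2 * ((Q x)\<^sup>2 * (u lam x)\<^sup>2)"
    using zero_le_power2[of "v lam x - Q x * u lam x"]
    by (simp add: du_def power2_sum power2_diff power_mult_distrib algebra_simps)
  moreover have "energy lam x = (du lam x)\<^sup>2 - ?p - (Q x)\<^sup>2 * (u lam x)\<^sup>2"
    by (simp add: energy_def algebra_simps)
  moreover have "0 \<le> (du lam x)\<^sup>2" "0 \<le> (v lam x)\<^sup>2" "0 \<le> (Q x)\<^sup>2 * (u lam x)\<^sup>2" by simp_all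
  moreover have "0 \<le> K\<^sup>2 * (v lam x)\<^sup>2" by simp
  moreover have "(3 + 3 * K\<^sup>2) * ?h x = 3 * (v lam x)\<^sup>2 + 3 * ?p + 3 * (K\<^sup>2 * (v lam x)\<^sup>2) + 3 * (K\<^sup>2 * ?p)"
    by (simp add: algebra_simps)
  moreover have "\<bar>e\<bar> \<le> h" if "k \<le> kp" "d \<le> 2 * w + 2 * k" "e = d - p - k" "0 \<le> d" "0 \<le> w" "0 \<le> k"
      "0 \<le> kw" "h = 3 * w + 3 * p + 3 * kw + 3 * kp" "0 \<le> p" for e h k kp d w p kw :: real
    using that by linarith
  ultimately have "\<bar>energy lam x\<bar> \<le> (3 + 3 * K\<^sup>2) * ?h x" using p by blast
  also have "\<dots> < e" using x(3) K1 by (simp add: field_simps)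
  finally show ?thesis using x \<open>0 \<le> x\<close> by blast
qed

section \<open>The norm of the solution and the final limits\<close>

definition right_const :: real where
  "right_const = 2 + 2 * (K + 1) * ((1 + 2 * K) * growth)"

lemma right_const_pos: "0 < right_const"
  unfolding right_const_def using K_nonneg growth_pos
  by (intro add_pos_nonneg mult_nonneg_nonneg) auto

text \<open>The energy balance from \<open>0\<close> to a distant point. The three errors are the
  remaining energy, the perturbation up to \<open>lam / 2\<close> with its factor
  \<open>sqrt (lam / 2)\<close> gained, and the perturbation beyond, where only the tail of
  \<open>q\<close> is small.\<close>

lemma norm_estimate:
  assumes eig: "lam \<in> eigenvalues_N q"
    and lam: "4 \<le> lam" "K \<le> sqrt (lam / 2) / 4"
    and tail: "\<And>b. integral {lam/2..b} (\<lambda>x. \<bar>q x\<bar>) \<le> d" and d: "d \<le> 1/4"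
  shows "\<bar>integral {0..} (\<lambda>x. (u lam x)\<^sup>2) - lam\<bar>
    \<le> 1 + 2 * lam / sqrt (lam / 2) * K + right_const * lam * d"
proof -
  define R where "R = 1 + 2 * lam / sqrt (lam / 2) * K + right_const * lam * d"
  define J where "J x = integral {0..x} (\<lambda>x. (u lam x)\<^sup>2)" for x
  have cont: "continuous_on {0..} (\<lambda>x. (u lam x)\<^sup>2)" by (intro continuous_intros u_cont)
  have L2: "(\<lambda>x. (u lam x)\<^sup>2) integrable_on {0..}" using eig by (simp add: eigenvalues_eq)
  obtain I where I: "((\<lambda>x. (u lam x)\<^sup>2) has_integral I) {0..}" "(J \<longlongrightarrow> I) at_top"
    unfolding J_def
    by (rule nonneg_continuous_has_integral_atLeast[OF cont _ integral_le_integral_atLeast[OF L2]]) auto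
  have E: "energy lam x \<le> 2 * lam" if "x \<in> {0..lam - 1}" for x
    by (rule energy_bound[OF lam order_trans[OF tail d] that])
  have left: "2 * \<bar>u lam x * du lam x\<bar> \<le> 2 * lam / sqrt (lam / 2)" if "x \<in> {0..lam / 2}" for x
    by (rule u_du_le_energy_left) (use E that lam in auto)
  \<comment> \<open>The summand \<open>2\<close> of \<open>right_const\<close> serves up to
    \<open>lam - 1\<close>, where the energy bound still applies; the other serves beyond.\<close>
  have right: "2 * \<bar>u lam x * du lam x\<bar> \<le> right_const * lam" if "lam / 2 \<le> x" for x
  proof (cases "x \<le> lam - 1")
    case True
    have "2 * \<bar>u lam x * du lam x\<bar> \<le> 2 * lam"
      using E[of x] True that lam by (intro u_du_le_energy_mid) auto
    also have "\<dots> \<le> right_const * lam"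
      using K_nonneg growth_pos lam unfolding right_const_def
      by (intro mult_right_mono) (auto intro!: mult_nonneg_nonneg)
    finally show ?thesis .
  next
    case False
    have "2 * \<bar>u lam x * du lam x\<bar> \<le> 2 * (K + 1) * ((1 + 2 * K) * growth * lam)"
      by (rule u_du_right_bound[OF eig]) (use E[of "lam - 1"] lam False in auto)
    also have "\<dots> = (2 * (K + 1) * ((1 + 2 * K) * growth)) * lam" by (simp add: algebra_simps)
    also have "\<dots> \<le> right_const * lam"
      using lam unfolding right_const_def by (intro mult_right_mono) auto
    finally show ?thesis .
  qed
  have key: "\<exists>x\<ge>y. \<bar>J x - lam\<bar> \<le> R" for y
  proof -
    obtain x where x: "0 \<le> x" "max y lam \<le> x" "\<bar>energy lam x\<bar> < 1"
      using energy_small[OF eig, of 1 "max y lam"] by auto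
    have "\<bar>energy lam (lam/2) - energy lam 0 + J (lam/2)\<bar>
        \<le> 2 * lam / sqrt (lam / 2) * integral {0..lam/2} (\<lambda>x. \<bar>q x\<bar>)"
      unfolding J_def by (rule energy_diff) (use left lam in auto)
    also have "\<dots> \<le> 2 * lam / sqrt (lam / 2) * K"
      using lam integral_abs_q_le[of 0 "lam/2"] by (intro mult_left_mono) auto
    finally have 1: "\<bar>energy lam (lam/2) - lam + J (lam/2)\<bar> \<le> 2 * lam / sqrt (lam / 2) * K"
      by (simp add: energy_0)
    have "\<bar>energy lam x - energy lam (lam/2) + integral {lam/2..x} (\<lambda>x. (u lam x)\<^sup>2)\<bar>
        \<le> right_const * lam * integral {lam/2..x} (\<lambda>x. \<bar>q x\<bar>)"
      by (rule energy_diff) (use right lam x in auto)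
    also have "\<dots> \<le> right_const * lam * d"
      using tail lam right_const_pos by (intro mult_left_mono) auto
    finally have 2: "\<bar>energy lam x - energy lam (lam/2) + integral {lam/2..x} (\<lambda>x. (u lam x)\<^sup>2)\<bar>
        \<le> right_const * lam * d" .
    have "J (lam/2) + integral {lam/2..x} (\<lambda>x. (u lam x)\<^sup>2) = J x"
      unfolding J_def using x lam
      by (intro Henstock_Kurzweil_Integration.integral_combine continuous_integrable_Icc cont) auto
    then have "\<bar>J x - lam\<bar> \<le> R" using 1 2 x(3) unfolding R_def by linarith
    then show ?thesis using x(2) by auto
  qed
  \<comment> \<open>The estimate is known only at some arbitrarily distant points; since
    \<open>J\<close> converges, this is enough.\<close>
  have "\<bar>I - lam\<bar> \<le> R"
  proof (rule ccontr)
    assume "\<not> \<bar>I - lam\<bar> \<le> R"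
    moreover have "((\<lambda>x. \<bar>J x - lam\<bar>) \<longlongrightarrow> \<bar>I - lam\<bar>) at_top" by (intro tendsto_intros I)
    ultimately have "\<forall>\<^sub>F x in at_top. R < \<bar>J x - lam\<bar>" by (intro order_tendstoD) auto
    then obtain y where "\<And>x. y \<le> x \<Longrightarrow> R < \<bar>J x - lam\<bar>" by (auto simp: eventually_at_top_linorder)
    then show False using key[of y] by force
  qed
  then show ?thesis using I(1) by (simp add: R_def integral_unique)
qed

lemma norm_asymptotic:
  "((\<lambda>m. integral {0..} (\<lambda>x. (u (mu m) x)\<^sup>2) / mu m) \<longlongrightarrow> 1) sequentially"
proof (rule LIM_zero_cancel, rule tendstoI)
  fix e :: real assume "0 < e"
  \<comment> \<open>The first bound is what \<open>norm_estimate\<close> requires; the second makes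
    the tail term at most \<open>e / 4 * l\<close>.\<close>
  define d where "d = min (1/4) (e / (4 * right_const))"
  have "0 < d" using \<open>0 < e\<close> right_const_pos by (simp add: d_def)
  then obtain R where R: "0 \<le> R" "\<And>a b. R \<le> a \<Longrightarrow> integral {a..b} (\<lambda>x. \<bar>q x\<bar>) \<le> d"
    using abs_q_tail by blast
  have sqrt_top: "filterlim (\<lambda>l. sqrt (l / 2)) at_top (at_top :: real filter)"
    using filterlim_compose[OF sqrt_at_top
        filterlim_tendsto_pos_mult_at_top[OF tendsto_const[of "1/2"] _ filterlim_ident]] by simp
  have "\<forall>\<^sub>F l in at_top. 4 * K \<le> sqrt (l / 2)" "\<forall>\<^sub>F l in at_top. 8 * K / e \<le> sqrt (l / 2)"
    using sqrt_top by (auto simp: filterlim_at_top)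
  moreover have "\<forall>\<^sub>F l in at_top. max (max 4 (2 * R)) (4 / e + 1) \<le> (l::real)" by (rule eventually_ge_at_top)
  ultimately have ev: "\<forall>\<^sub>F l in at_top. l \<in> eigenvalues_N q \<longrightarrow>
      dist (integral {0..} (\<lambda>x. (u l x)\<^sup>2) / l - 1) 0 < e"
  proof eventually_elim
    case (elim l)
    show ?case
    proof
      assume eig: "l \<in> eigenvalues_N q"
      have l: "4 \<le> l" "R \<le> l / 2" "4 / e + 1 \<le> l" using elim by auto
      have sq: "0 < sqrt (l / 2)" using l by simp
      have "\<bar>integral {0..} (\<lambda>x. (u l x)\<^sup>2) - l\<bar>
          \<le> 1 + 2 * l / sqrt (l / 2) * K + right_const * l * d"
        by (rule norm_estimate[OF eig]) (use elim l R in \<open>auto simp: d_def\<close>)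
      also have "1 < e / 4 * l" using l(3) \<open>0 < e\<close> by (simp add: field_simps)
      also have "2 * l / sqrt (l / 2) * K \<le> e / 4 * l"
      proof -
        have "2 * K / sqrt (l / 2) \<le> e / 4" using elim(2) sq \<open>0 < e\<close> by (simp add: field_simps)
        then have "2 * K / sqrt (l / 2) * l \<le> e / 4 * l" using l by (intro mult_right_mono) auto
        then show ?thesis by (simp add: mult_ac)
      qed
      also have "right_const * l * d \<le> e / 4 * l"
      proof -
        have "right_const * d \<le> right_const * (e / (4 * right_const))"
          using right_const_pos by (intro mult_left_mono) (auto simp: d_def)
        also have "\<dots> = e / 4" using right_const_pos by simp
        finally have "right_const * d * l \<le> e / 4 * l" using l by (intro mult_right_mono) auto
        then show ?thesis by (simp add: mult_ac)
      qed
      finally have "\<bar>integral {0..} (\<lambda>x. (u l x)\<^sup>2) - l\<bar> < e / 4 * l + e / 4 * l + e / 4 * l"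
        by simp
      moreover have "0 < e * l" using l \<open>0 < e\<close> by simp
      ultimately have "\<bar>integral {0..} (\<lambda>x. (u l x)\<^sup>2) - l\<bar> < e * l" by linarith
      moreover have "integral {0..} (\<lambda>x. (u l x)\<^sup>2) / l - 1 = (integral {0..} (\<lambda>x. (u l x)\<^sup>2) - l) / l"
        using l by (simp add: field_simps)
      ultimately show "dist (integral {0..} (\<lambda>x. (u l x)\<^sup>2) / l - 1) 0 < e"
        using l by (simp add: pos_divide_less_eq)
    qed
  qed
  then have "\<forall>\<^sub>F m in sequentially. mu m \<in> eigenvalues_N q \<longrightarrow>
      dist (integral {0..} (\<lambda>x. (u (mu m) x)\<^sup>2) / mu m - 1) 0 < e"
    using mu_at_top by (rule eventually_compose_filterlim)
  then show "\<forall>\<^sub>F m in sequentially. dist (integral {0..} (\<lambda>x. (u (mu m) x)\<^sup>2) / mu m - 1) 0 < e"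
    by (simp add: eigenvalues_eq_range)
qed

text \<open>Compared with the cube of \<open>sqrt (mu m)\<close>, the phase error
  \<open>O(mu m)\<close> is of relative size \<open>O(1 / sqrt (mu m))\<close>. The power
  \<open>2/3\<close> turns the cube into \<open>mu m\<close>.\<close>

lemma eigenvalue_asymptotic:
  "((\<lambda>m. (3 / 2 * pi * (real (Suc m) - 3 / 4)) powr (2 / 3) / mu m) \<longlongrightarrow> 1) sequentially"
proof -
  let ?s = "\<lambda>m. sqrt (mu m)"
  have s_top: "filterlim ?s at_top sequentially"
    by (rule filterlim_compose[OF sqrt_at_top mu_at_top])
  have pos: "\<forall>\<^sub>F m in sequentially. 1 \<le> mu m"
    using mu_at_top by (simp add: filterlim_at_top)
  define B where "B = 3/2 * (phase_error + 4) + 3/2 * pi"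
  have "((\<lambda>m. 3 / 2 * pi * (real (Suc m) - 3 / 4) / ?s m ^ 3 - 1) \<longlongrightarrow> 0) sequentially"
  proof (rule Lim_null_comparison)
    show "\<forall>\<^sub>F m in sequentially. norm (3 / 2 * pi * (real (Suc m) - 3 / 4) / ?s m ^ 3 - 1) \<le> B / ?s m"
      using pos
    proof eventually_elim
      case (elim m)
      have s: "1 \<le> ?s m" "(?s m)\<^sup>2 = mu m" using elim by auto
      \<comment> \<open>Since \<open>Suc m - 3/4 = m + 1/4\<close>, the constant left over is
        \<open>3/2 * pi * 1/4 = 3/8 * pi\<close>.\<close>
      have "3 / 2 * pi * (real (Suc m) - 3 / 4) - ?s m ^ 3
          = 3/2 * (real m * pi - 2/3 * ?s m ^ 3) + 3/8 * pi"
        by (simp add: algebra_simps)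
      also have "\<bar>\<dots>\<bar> \<le> 3/2 * ((phase_error + 4) * mu m) + 3/2 * pi * 1"
      proof -
        have "\<bar>3/2 * z + 3/8 * p\<bar> \<le> 3/2 * c + 3/2 * p * 1" if "\<bar>z\<bar> \<le> c" "0 < p" for z p c :: real
          using that by linarith
        then show ?thesis using mu_phase[OF elim] pi_gt_zero by blast
      qed
      also have "\<dots> \<le> 3/2 * ((phase_error + 4) * mu m) + 3/2 * pi * mu m"
        using elim by (intro add_left_mono mult_left_mono) auto
      also have "\<dots> = B * (?s m)\<^sup>2" by (simp add: B_def s algebra_simps)
      finally have "\<bar>3 / 2 * pi * (real (Suc m) - 3 / 4) - ?s m ^ 3\<bar> / ?s m ^ 3 \<le> B * (?s m)\<^sup>2 / ?s m ^ 3"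
        using s by (intro divide_right_mono) auto
      also have "\<dots> = B / ?s m" using s by (simp add: power2_eq_square power3_eq_cube)
      finally have "\<bar>3 / 2 * pi * (real (Suc m) - 3 / 4) - ?s m ^ 3\<bar> / ?s m ^ 3 \<le> B / ?s m" .
      moreover have frac: "\<bar>z / w - 1\<bar> = \<bar>z - w\<bar> / w" if "0 < w" for z w :: real
      proof -
        have "z / w - 1 = (z - w) / w" using that by (simp add: field_simps)
        then show ?thesis using that by (simp add: abs_divide)
      qed
      moreover have "0 < ?s m ^ 3" using s by simp
      ultimately show ?case unfolding real_norm_def by (simp only: frac)
    qed
    show "((\<lambda>m. B / ?s m) \<longlongrightarrow> 0) sequentially"
      by (rule tendsto_divide_0[OF tendsto_const filterlim_at_top_imp_at_infinity[OF s_top]])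
  qed
  then have lim: "((\<lambda>m. 3 / 2 * pi * (real (Suc m) - 3 / 4) / ?s m ^ 3) \<longlongrightarrow> 1) sequentially"
    by (simp add: LIM_zero_iff)
  have "((\<lambda>m. (3 / 2 * pi * (real (Suc m) - 3 / 4) / ?s m ^ 3) powr (2 / 3)) \<longlongrightarrow> 1 powr (2 / 3)) sequentially"
    by (intro tendsto_powr lim tendsto_const) auto
  moreover have "\<forall>\<^sub>F m in sequentially. (3 / 2 * pi * (real (Suc m) - 3 / 4) / ?s m ^ 3) powr (2 / 3)
      = (3 / 2 * pi * (real (Suc m) - 3 / 4)) powr (2 / 3) / mu m"
    using pos
  proof eventually_elim
    case (elim m)
    have s: "1 \<le> ?s m" "(?s m)\<^sup>2 = mu m" using elim by auto
    have "(?s m ^ 3) powr (2 / 3) = (?s m powr 3) powr (2 / 3)"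
      using powr_realpow[of "?s m" 3] s by simp
    also have "\<dots> = ?s m powr 2" by (simp only: powr_powr) simp
    also have "\<dots> = mu m" using powr_realpow[of "?s m" 2] s by simp
    finally have "(?s m ^ 3) powr (2 / 3) = mu m" .
    then show ?case using s by (simp add: powr_divide powr_mult)
  qed
  ultimately show ?thesis by (auto intro: Lim_transform_eventually)
qed

lemma norming_asymptotic:
  "inv_norming_const_N q \<sim>[at_top] (\<lambda>k. (3 / 2 * pi * (real k - 3 / 4)) powr (2 / 3))"
proof (rule asymp_equivI')
  let ?r = "\<lambda>k. (3 / 2 * pi * (real k - 3 / 4)) powr (2 / 3)"
  have "((\<lambda>m. (integral {0..} (\<lambda>x. (u (mu m) x)\<^sup>2) / mu m) / (?r (Suc m) / mu m)) \<longlongrightarrow> 1 / 1) sequentially"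
    by (intro tendsto_divide norm_asymptotic eigenvalue_asymptotic) simp
  moreover have "\<forall>\<^sub>F m in sequentially. (integral {0..} (\<lambda>x. (u (mu m) x)\<^sup>2) / mu m) / (?r (Suc m) / mu m)
      = inv_norming_const_N q (Suc m) / ?r (Suc m)"
  proof -
    have "\<forall>\<^sub>F m in sequentially. 1 \<le> mu m" using mu_at_top by (simp add: filterlim_at_top)
    then show ?thesis by eventually_elim (simp add: inv_norming_const_N_eq)
  qed
  ultimately have "((\<lambda>m. inv_norming_const_N q (Suc m) / ?r (Suc m)) \<longlongrightarrow> 1) sequentially"
    by (auto intro: Lim_transform_eventually)
  then show "((\<lambda>k. inv_norming_const_N q k / ?r k) \<longlongrightarrow> 1) at_top"
    by (rule LIMSEQ_imp_Suc)
qed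

end

theorem theorem3p9:
  fixes q :: "real \<Rightarrow> real"
  assumes "q absolutely_integrable_on {0..}"
  shows "inv_norming_const_N q \<sim>[at_top]
           (\<lambda>k. (3 / 2 * pi * (real k - 3 / 4)) powr (2 / 3))"
proof -
  interpret airy_potential q by unfold_locales (rule assms)
  show ?thesis by (rule norming_asymptotic)
qed

end
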